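(* Let $\mathcal{S},\mathcal{T}$ be closed subspaces of a Hilbert space $\mathcal{H}$. Then $T=P_{\mathcal{S}}P_{\mathcal{T}}$ is S-decomposable if and only if there exist isometries $X,Y:\ell^2\to\mathcal{H}$, with range $\mathcal{S}$ and $\mathcal{T}$, respectively, such that $X^*Y\in\mathcal{B}(\ell^2)$ is a diagonal matrix.
   Context: For a closed subspace $\mathcal{S}\subset\mathcal{H}$, $P_{\mathcal{S}}$ denotes the orthogonal projection onto $\mathcal{S}$; $\mathcal{B}(\ell^2)$ is the space of bounded linear operators on $\ell^2$, and matrices of operators on $\ell^2$ are taken with respect to the canonical basis. A bounded operator $T$ on $\mathcal{H}$ is called S-decomposable if it has a singular value (Schmidt) decomposition $T=\sum_{n\ge 1} s_n\langle\,\cdot\,,\xi_n\rangle\psi_n$, where $\{\xi_n: n\ge 1\}$ and $\{\psi_n: n\ge 1\}$ are orthonormal systems and $s_n>0$; equivalently, $T^*T$ is diagonalizable.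
   Formalization: As stated false (S=H=ℓ², T={e_0}^⊥). For separable S,T proved: iff with X,Y isometric on ℓ²(I), ℓ²(J), zero on the complements; and with isometries on all of ℓ² if S,T are infinite-dimensional and dim S∩T^⊥ = dim T∩S^⊥. *)

theory Defs
  imports "HOL-Analysis.Analysis"
begin

section \<open>Complex Hilbert spaces\<close>

text \<open>
  The library only has real inner product spaces. A complex inner product space is a real one
  together with a complex scalar multiplication extending the real one and a sesquilinear form
  whose real part is the given real inner product; norm, topology and positive definiteness
  are thus those of \<^class>\<open>real_inner\<close>. The form is linear in the first argument.
\<close>

class complex_inner = real_inner +
  fixes scaleC :: "complex \<Rightarrow> 'a \<Rightarrow> 'a"  (infixr \<open>*\<^sub>C\<close> 75)
    and cinner :: "'a \<Rightarrow> 'a \<Rightarrow> complex"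
  assumes scaleC_add_right: "a *\<^sub>C (x + y) = a *\<^sub>C x + a *\<^sub>C y"
    and scaleC_add_left: "(a + b) *\<^sub>C x = a *\<^sub>C x + b *\<^sub>C x"
    and scaleC_scaleC: "a *\<^sub>C b *\<^sub>C x = (a * b) *\<^sub>C x"
    and scaleR_scaleC: "r *\<^sub>R x = complex_of_real r *\<^sub>C x"
    and cinner_commute: "cinner x y = cnj (cinner y x)"
    and cinner_add_left: "cinner (x + y) z = cinner x z + cinner y z"
    and cinner_scaleC_left: "cinner (a *\<^sub>C x) y = a * cinner x y"
    and inner_eq_Re_cinner: "inner x y = Re (cinner x y)"

class chilbert_space = complex_inner + complete_space

definition csubspace :: "'a::complex_inner set \<Rightarrow> bool" where
  "csubspace S \<longleftrightarrow> subspace S \<and> (\<forall>c. \<forall>x\<in>S. c *\<^sub>C x \<in> S)"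

text \<open>Real and complex linear spans of finite sets are interchangeable in the following notion.\<close>

definition infinite_dimensional :: "'a::real_vector set \<Rightarrow> bool" where
  "infinite_dimensional S \<longleftrightarrow> \<not> (\<exists>B. finite B \<and> S \<subseteq> span B)"

definition ortho_compl :: "'a::complex_inner set \<Rightarrow> 'a set" where
  "ortho_compl S = {x. \<forall>y\<in>S. cinner x y = 0}"

definition bounded_clinear :: "('a::complex_inner \<Rightarrow> 'b::complex_inner) \<Rightarrow> bool" where
  "bounded_clinear A \<longleftrightarrow> bounded_linear A \<and> (\<forall>c x. A (c *\<^sub>C x) = c *\<^sub>C A x)"

text \<open>On a bounded operator between Hilbert spaces this is the Hilbert space adjoint, which
  exists and is unique by the Riesz representation theorem.\<close>

definition cadjoint :: "('a::chilbert_space \<Rightarrow> 'b::chilbert_space) \<Rightarrow> 'b \<Rightarrow> 'a" where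
  "cadjoint A = (SOME B. \<forall>x y. cinner (A x) y = cinner x (B y))"

text \<open>The orthogonal projection onto a closed subspace.\<close>

definition proj :: "'a::chilbert_space set \<Rightarrow> 'a \<Rightarrow> 'a" where
  "proj S x = (THE y. y \<in> S \<and> x - y \<in> ortho_compl S)"

definition isometric_on :: "'a::complex_inner set \<Rightarrow> ('a \<Rightarrow> 'b::complex_inner) \<Rightarrow> bool" where
  "isometric_on M U \<longleftrightarrow> bounded_clinear U \<and> (\<forall>x\<in>M. norm (U x) = norm x)"

abbreviation isometry :: "('a::complex_inner \<Rightarrow> 'b::complex_inner) \<Rightarrow> bool" where
  "isometry \<equiv> isometric_on UNIV"

text \<open>Equality of the Hilbert dimensions of two closed subspaces, expressed by a unitary map
  from one onto the other (which extends to the whole space by zero on the orthogonal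
  complement).\<close>

definition same_hilbert_dim :: "'a::complex_inner set \<Rightarrow> 'a set \<Rightarrow> bool" where
  "same_hilbert_dim M N \<longleftrightarrow> (\<exists>U. isometric_on M U \<and> U ` M = N)"

section \<open>Operators with a singular value decomposition\<close>

definition orthonormal_family :: "nat set \<Rightarrow> (nat \<Rightarrow> 'a::complex_inner) \<Rightarrow> bool" where
  "orthonormal_family N u \<longleftrightarrow>
     (\<forall>m\<in>N. \<forall>n\<in>N. cinner (u m) (u n) = (if m = n then 1 else 0))"

text \<open>The index set \<open>N\<close> may be finite or empty, so finite rank operators are included. The
  series converges in the strong sense, i.e. pointwise; since its terms are pairwise orthogonal,
  unconditional convergence is the same as convergence of the partial sums.\<close>

definition S_decomposable :: "('a::chilbert_space \<Rightarrow> 'a) \<Rightarrow> bool" where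
  "S_decomposable A \<longleftrightarrow> bounded_clinear A \<and>
     (\<exists>(N :: nat set) (s :: nat \<Rightarrow> real) \<xi> \<psi>.
        orthonormal_family N \<xi> \<and> orthonormal_family N \<psi> \<and> (\<forall>n\<in>N. s n > 0) \<and>
        (\<forall>x. ((\<lambda>n. (complex_of_real (s n) * cinner x (\<xi> n)) *\<^sub>C \<psi> n) has_sum A x) N))"

section \<open>The Hilbert space \<open>\<ell>\<^sup>2\<close>\<close>

typedef ell2 = "{f :: nat \<Rightarrow> complex. summable (\<lambda>n. (cmod (f n))\<^sup>2)}"
  morphisms ell2_nth Abs_ell2
  by (rule exI[of _ "\<lambda>_. 0"]) simp

setup_lifting type_definition_ell2

lemma ell2_summable: "summable (\<lambda>n. (cmod (ell2_nth x n))\<^sup>2)"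
  using ell2_nth[of x] by simp

lemma cmod_add_sq_le: "(cmod (a + b))\<^sup>2 \<le> 2 * (cmod a)\<^sup>2 + 2 * (cmod b)\<^sup>2"
proof -
  have "(cmod (a + b))\<^sup>2 \<le> (cmod a + cmod b)\<^sup>2"
    by (intro power_mono norm_triangle_ineq) simp
  also have "\<dots> \<le> 2 * (cmod a)\<^sup>2 + 2 * (cmod b)\<^sup>2"
    using sum_squares_bound[of "cmod a" "cmod b"] by (simp add: power2_sum)
  finally show ?thesis .
qed

lemma ell2_add_closed:
  assumes "summable (\<lambda>n. (cmod (f n))\<^sup>2)" "summable (\<lambda>n. (cmod (g n))\<^sup>2)"
  shows "summable (\<lambda>n. (cmod (f n + g n))\<^sup>2)"
proof (rule summable_comparison_test')
  show "summable (\<lambda>n. 2 * (cmod (f n))\<^sup>2 + 2 * (cmod (g n))\<^sup>2)"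
    using assms by (intro summable_add summable_mult)
qed (use cmod_add_sq_le in auto)

lemma ell2_scale_closed:
  assumes "summable (\<lambda>n. (cmod (f n))\<^sup>2)"
  shows "summable (\<lambda>n. (cmod (c * f n))\<^sup>2)"
  using summable_mult[OF assms, of "(cmod c)\<^sup>2"] by (simp add: norm_mult power_mult_distrib)

instantiation ell2 :: complex_inner
begin

lift_definition zero_ell2 :: ell2 is "\<lambda>_. 0" by simp
lift_definition plus_ell2 :: "ell2 \<Rightarrow> ell2 \<Rightarrow> ell2" is "\<lambda>f g n. f n + g n"
  by (rule ell2_add_closed)
lift_definition uminus_ell2 :: "ell2 \<Rightarrow> ell2" is "\<lambda>f n. - f n" by simp
lift_definition minus_ell2 :: "ell2 \<Rightarrow> ell2 \<Rightarrow> ell2" is "\<lambda>f g n. f n - g n"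
  using ell2_add_closed[where g = "\<lambda>n. - g n" for g] by simp
lift_definition scaleC_ell2 :: "complex \<Rightarrow> ell2 \<Rightarrow> ell2" is "\<lambda>c f n. c * f n"
  by (rule ell2_scale_closed)
definition scaleR_ell2 :: "real \<Rightarrow> ell2 \<Rightarrow> ell2" where
  "scaleR_ell2 r x = complex_of_real r *\<^sub>C x"
definition cinner_ell2 :: "ell2 \<Rightarrow> ell2 \<Rightarrow> complex" where
  "cinner_ell2 x y = (\<Sum>n. ell2_nth x n * cnj (ell2_nth y n))"
definition inner_ell2 :: "ell2 \<Rightarrow> ell2 \<Rightarrow> real" where
  "inner_ell2 x y = Re (cinner x y)"
definition norm_ell2 :: "ell2 \<Rightarrow> real" where
  "norm_ell2 x = sqrt (inner x x)"
definition sgn_ell2 :: "ell2 \<Rightarrow> ell2" where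
  "sgn_ell2 x = inverse (norm x) *\<^sub>R x"
definition dist_ell2 :: "ell2 \<Rightarrow> ell2 \<Rightarrow> real" where
  "dist_ell2 x y = norm (x - y)"
definition uniformity_ell2 :: "(ell2 \<times> ell2) filter" where
  "uniformity_ell2 = (INF e\<in>{0<..}. principal {(x, y). dist x y < e})"
definition open_ell2 :: "ell2 set \<Rightarrow> bool" where
  "open_ell2 U = (\<forall>x\<in>U. \<forall>\<^sub>F (x', y) in uniformity. x' = x \<longrightarrow> y \<in> U)"

lemma ell2_cinner_summable: "summable (\<lambda>n. ell2_nth x n * cnj (ell2_nth y n))"
proof (rule summable_comparison_test')
  show "summable (\<lambda>n. (cmod (ell2_nth x n))\<^sup>2 + (cmod (ell2_nth y n))\<^sup>2)"
    by (intro summable_add ell2_summable)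
  show "norm (ell2_nth x n * cnj (ell2_nth y n))
          \<le> (cmod (ell2_nth x n))\<^sup>2 + (cmod (ell2_nth y n))\<^sup>2" for n
    using sum_squares_bound[of "cmod (ell2_nth x n)" "cmod (ell2_nth y n)"]
      mult_nonneg_nonneg[OF norm_ge_zero[of "ell2_nth x n"] norm_ge_zero[of "ell2_nth y n"]]
    unfolding norm_mult complex_mod_cnj by linarith
qed

lemma ell2_inner_self: "inner x x = (\<Sum>n. (cmod (ell2_nth x n))\<^sup>2)" for x :: ell2
proof -
  have "cinner x x = (\<Sum>n. complex_of_real ((cmod (ell2_nth x n))\<^sup>2))"
    unfolding cinner_ell2_def by (simp only: complex_norm_square)
  also have "\<dots> = complex_of_real (\<Sum>n. (cmod (ell2_nth x n))\<^sup>2)"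
    by (rule suminf_of_real[OF ell2_summable, symmetric])
  finally show ?thesis by (simp add: inner_ell2_def)
qed

lemma ell2_cinner_commute: "cinner x y = cnj (cinner y x)" for x y :: ell2
  using sums_cnj[THEN iffD2, OF summable_sums[OF ell2_cinner_summable[of y x]]]
  by (simp add: cinner_ell2_def sums_iff mult.commute)

lemma ell2_cinner_add_left: "cinner (x + y) z = cinner x z + cinner y z" for x y z :: ell2
  using suminf_add[OF ell2_cinner_summable[of x z] ell2_cinner_summable[of y z]]
  by (simp add: cinner_ell2_def plus_ell2.rep_eq algebra_simps)

lemma ell2_cinner_scaleC_left: "cinner (a *\<^sub>C x) y = a * cinner x y" for x y :: ell2
  using suminf_mult[OF ell2_cinner_summable[of x y], of a]
  by (simp add: cinner_ell2_def scaleC_ell2.rep_eq mult.assoc)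

instance
proof
  fix x y z :: ell2 and a b :: complex and r s :: real
  show "x + y + z = x + (y + z)" "x + y = y + x" "0 + x = x" "- x + x = 0" "x - y = x + - y"
    by (transfer; simp add: algebra_simps)+
  show "a *\<^sub>C (x + y) = a *\<^sub>C x + a *\<^sub>C y" "(a + b) *\<^sub>C x = a *\<^sub>C x + b *\<^sub>C x"
    "a *\<^sub>C b *\<^sub>C x = (a * b) *\<^sub>C x"
    by (transfer; simp add: algebra_simps)+
  show "r *\<^sub>R (x + y) = r *\<^sub>R x + r *\<^sub>R y" "(r + s) *\<^sub>R x = r *\<^sub>R x + s *\<^sub>R x"
    "r *\<^sub>R s *\<^sub>R x = (r * s) *\<^sub>R x" "1 *\<^sub>R x = x"
    unfolding scaleR_ell2_def by (transfer; simp add: algebra_simps)+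
  show "r *\<^sub>R x = complex_of_real r *\<^sub>C x" by (rule scaleR_ell2_def)
  show "cinner x y = cnj (cinner y x)" by (rule ell2_cinner_commute)
  show "cinner (x + y) z = cinner x z + cinner y z" by (rule ell2_cinner_add_left)
  show "cinner (a *\<^sub>C x) y = a * cinner x y" by (rule ell2_cinner_scaleC_left)
  show "inner x y = Re (cinner x y)" by (rule inner_ell2_def)
  show "inner x y = inner y x"
    unfolding inner_ell2_def by (subst ell2_cinner_commute) simp
  show "inner (x + y) z = inner x z + inner y z"
    by (simp add: inner_ell2_def ell2_cinner_add_left)
  show "inner (r *\<^sub>R x) y = r * inner x y"
    by (simp add: inner_ell2_def scaleR_ell2_def ell2_cinner_scaleC_left)
  show "0 \<le> inner x x"
    unfolding ell2_inner_self by (rule suminf_nonneg[OF ell2_summable]) simp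
  show "inner x x = 0 \<longleftrightarrow> x = 0"
    unfolding ell2_inner_self
    by (subst suminf_eq_zero_iff[OF ell2_summable]) (auto simp: ell2_nth_inject[symmetric] zero_ell2.rep_eq)
  show "norm x = sqrt (inner x x)" by (rule norm_ell2_def)
  show "sgn x = inverse (norm x) *\<^sub>R x" by (rule sgn_ell2_def)
  show "dist x y = norm (x - y)" by (rule dist_ell2_def)
  show "uniformity = (INF e\<in>{0<..}. principal {(x :: ell2, y). dist x y < e})"
    by (rule uniformity_ell2_def)
  show "open U \<longleftrightarrow> (\<forall>x\<in>U. \<forall>\<^sub>F (x', y) in uniformity. x' = x \<longrightarrow> y \<in> U)" for U :: "ell2 set"
    by (rule open_ell2_def)
qed

end

lemma ell2_norm_sq: "(norm x)\<^sup>2 = (\<Sum>n. (cmod (ell2_nth x n))\<^sup>2)"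
  by (simp add: power2_norm_eq_inner ell2_inner_self)

lemma ell2_sum_le: "finite F \<Longrightarrow> (\<Sum>n\<in>F. (cmod (ell2_nth x n))\<^sup>2) \<le> (norm x)\<^sup>2"
  unfolding ell2_norm_sq by (rule sum_le_suminf[OF ell2_summable]) auto

lemma ell2_nth_le: "cmod (ell2_nth x n) \<le> norm x"
  using ell2_sum_le[of "{n}" x] by (auto intro: power2_le_imp_le)

instance ell2 :: chilbert_space
proof
  fix X :: "nat \<Rightarrow> ell2"
  assume X: "Cauchy X"
  have "convergent (\<lambda>m. ell2_nth (X m) n)" for n
  proof (rule Cauchy_convergent, rule CauchyI)
    fix e :: real assume "0 < e"
    then obtain M where M: "\<forall>m\<ge>M. \<forall>k\<ge>M. norm (X m - X k) < e" using CauchyD[OF X] by blast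
    have "norm (ell2_nth (X m) n - ell2_nth (X k) n) < e" if "m \<ge> M" "k \<ge> M" for m k
      using ell2_nth_le[of "X m - X k" n] M that by (force simp: minus_ell2.rep_eq)
    then show "\<exists>M. \<forall>m\<ge>M. \<forall>k\<ge>M. norm (ell2_nth (X m) n - ell2_nth (X k) n) < e" by blast
  qed
  then obtain g where g: "\<And>n. (\<lambda>m. ell2_nth (X m) n) \<longlonglongrightarrow> g n"
    unfolding convergent_def by metis
  have bound: "(\<Sum>n<K. (cmod (ell2_nth (X m) n - g n))\<^sup>2) \<le> e\<^sup>2"
    if M: "\<forall>m\<ge>M. \<forall>k\<ge>M. norm (X m - X k) < e" and "m \<ge> M" for M m K e
  proof (rule tendsto_upperbound)
    show "(\<lambda>k. \<Sum>n<K. (cmod (ell2_nth (X m) n - ell2_nth (X k) n))\<^sup>2)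
            \<longlonglongrightarrow> (\<Sum>n<K. (cmod (ell2_nth (X m) n - g n))\<^sup>2)"
      by (intro tendsto_intros g)
    have "(\<Sum>n<K. (cmod (ell2_nth (X m) n - ell2_nth (X k) n))\<^sup>2) \<le> e\<^sup>2" if "k \<ge> M" for k
    proof -
      have "(\<Sum>n<K. (cmod (ell2_nth (X m) n - ell2_nth (X k) n))\<^sup>2) \<le> (norm (X m - X k))\<^sup>2"
        using ell2_sum_le[of "{..<K}" "X m - X k"] by (simp add: minus_ell2.rep_eq)
      also have "\<dots> \<le> e\<^sup>2"
        using M that \<open>m \<ge> M\<close> by (intro power_mono) (auto intro: less_imp_le)
      finally show ?thesis .
    qed
    then show "\<forall>\<^sub>F k in sequentially.
        (\<Sum>n<K. (cmod (ell2_nth (X m) n - ell2_nth (X k) n))\<^sup>2) \<le> e\<^sup>2"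
      unfolding eventually_sequentially by blast
  qed simp
  have diff: "summable (\<lambda>n. (cmod (ell2_nth (X m) n - g n))\<^sup>2)"
      "(\<Sum>n. (cmod (ell2_nth (X m) n - g n))\<^sup>2) \<le> e\<^sup>2"
    if "\<forall>m\<ge>M. \<forall>k\<ge>M. norm (X m - X k) < e" and "m \<ge> M" for M m e
  proof -
    show *: "summable (\<lambda>n. (cmod (ell2_nth (X m) n - g n))\<^sup>2)"
      by (rule summableI_nonneg_bounded[where x = "e\<^sup>2"]) (use bound[OF that] in auto)
    show "(\<Sum>n. (cmod (ell2_nth (X m) n - g n))\<^sup>2) \<le> e\<^sup>2"
      by (rule suminf_le_const[OF *]) (rule bound[OF that])
  qed
  obtain M1 where M1: "\<forall>m\<ge>M1. \<forall>k\<ge>M1. norm (X m - X k) < 1"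
    using CauchyD[OF X, of 1] by auto
  have "summable (\<lambda>n. (cmod (- (ell2_nth (X M1) n - g n) + ell2_nth (X M1) n))\<^sup>2)"
    by (rule ell2_add_closed[OF _ ell2_summable])
       (use diff(1)[OF M1 order_refl] in \<open>simp add: norm_minus_commute\<close>)
  then have "summable (\<lambda>n. (cmod (g n))\<^sup>2)" by simp
  then have G: "ell2_nth (Abs_ell2 g) = g" by (simp add: Abs_ell2_inverse)
  have "X \<longlonglongrightarrow> Abs_ell2 g"
  proof (rule LIMSEQ_I)
    fix e :: real assume e: "0 < e"
    then obtain M where M: "\<forall>m\<ge>M. \<forall>k\<ge>M. norm (X m - X k) < e / 2"
      using CauchyD[OF X, of "e / 2"] by auto
    have "norm (X m - Abs_ell2 g) < e" if "m \<ge> M" for m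
    proof -
      have "(norm (X m - Abs_ell2 g))\<^sup>2 \<le> (e / 2)\<^sup>2"
        using diff(2)[OF M that] by (simp add: ell2_norm_sq minus_ell2.rep_eq G)
      then have "norm (X m - Abs_ell2 g) \<le> e / 2"
        by (rule power2_le_imp_le) (use e in simp)
      then show ?thesis using e by simp
    qed
    then show "\<exists>M. \<forall>m\<ge>M. norm (X m - Abs_ell2 g) < e" by blast
  qed
  then show "convergent X" by (rule convergentI)
qed

lift_definition ell2_basis :: "nat \<Rightarrow> ell2" is "\<lambda>k n. if n = k then 1 else 0"
  by (rule summable_finite[where N = "{k}" for k]) auto

definition matrix_entry :: "(ell2 \<Rightarrow> ell2) \<Rightarrow> nat \<Rightarrow> nat \<Rightarrow> complex" where
  "matrix_entry A i j = cinner (A (ell2_basis j)) (ell2_basis i)"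

definition diagonal_matrix :: "(ell2 \<Rightarrow> ell2) \<Rightarrow> bool" where
  "diagonal_matrix A \<longleftrightarrow> (\<forall>i j. i \<noteq> j \<longrightarrow> matrix_entry A i j = 0)"

text \<open>The canonical copy of \<open>\<ell>\<^sup>2(I)\<close> inside \<open>\<ell>\<^sup>2 = \<ell>\<^sup>2(\<nat>)\<close>.\<close>

definition ell2_on :: "nat set \<Rightarrow> ell2 set" where
  "ell2_on I = {x. \<forall>n. n \<notin> I \<longrightarrow> ell2_nth x n = 0}"

text \<open>An isometry defined on \<open>\<ell>\<^sup>2(I)\<close>, extended to \<open>\<ell>\<^sup>2\<close> by zero on the orthogonal complement
  \<open>\<ell>\<^sup>2(- I)\<close> of \<open>\<ell>\<^sup>2(I)\<close>. For \<open>I = UNIV\<close> this is just an isometry on \<open>\<ell>\<^sup>2\<close>, and for a finite set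
  of \<open>d\<close> indices it is an isometry on a space of dimension \<open>d\<close>.\<close>

definition coord_isometry :: "nat set \<Rightarrow> (ell2 \<Rightarrow> 'a::complex_inner) \<Rightarrow> bool" where
  "coord_isometry I X \<longleftrightarrow> isometric_on (ell2_on I) X \<and> (\<forall>x \<in> ell2_on (- I). X x = 0)"

end

theory Submission
  imports Defs
begin

text \<open>
  Isometries \<open>X\<close>, \<open>Y\<close> as in the statement amount to orthonormal bases \<open>f\<close> of \<open>S\<close> and \<open>g\<close> of \<open>T\<close>
  with \<open>\<langle>g j, f i\<rangle> = 0\<close> for \<open>i \<noteq> j\<close>, and such a pair turns \<open>P\<^sub>S P\<^sub>T\<close> into
  \<open>\<Sum>j. \<langle>g j, f j\<rangle> \<langle>\<cdot>, g j\<rangle> f j\<close>, a singular value decomposition once the phases of the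
  coefficients are absorbed into the \<open>f j\<close>. Conversely, the singular vectors \<open>\<psi> n\<close>, \<open>\<xi> n\<close> of \<open>P\<^sub>S P\<^sub>T\<close>
  lie in \<open>S\<close> and \<open>T\<close> and are biorthogonal up to scaling, and what they leave uncovered is
  exactly \<open>S \<inter> T\<^sup>\<bottom>\<close> and \<open>T \<inter> S\<^sup>\<bottom>\<close>. Arbitrary orthonormal bases of these two subspaces
  complete the families without creating off-diagonal entries; if the two dimensions agree, the
  same index set serves for both.
\<close>

section \<open>Complex inner product spaces\<close>

lemma cinner_add_right: "cinner x (y + z) = cinner x y + cinner x z"
  by (metis cinner_add_left cinner_commute complex_cnj_add)

lemma cinner_scaleC_right: "cinner x (a *\<^sub>C y) = cnj a * cinner x y"
  by (metis cinner_commute cinner_scaleC_left complex_cnj_mult)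

text \<open>Together with \<open>inner_eq_Re_cinner\<close> this lets the real inner product
  determine the whole complex form, so real polarization carries over to complex isometries.\<close>

lemma Im_cinner_eq_inner: "Im (cinner x y) = - inner (\<i> *\<^sub>C x) y"
  by (simp add: inner_eq_Re_cinner cinner_scaleC_left)

lemma cinner_self: "cinner x x = complex_of_real ((norm x)\<^sup>2)"
proof -
  have "Im (cinner x x) = 0"
    using cinner_commute[of x x] by (simp add: complex_eq_iff)
  then show ?thesis
    by (simp add: complex_eq_iff power2_norm_eq_inner inner_eq_Re_cinner)
qed

lemma cinner_self_eq_0_iff: "cinner x x = 0 \<longleftrightarrow> x = 0"
  by (simp add: cinner_self)

lemma scaleC_scaleR: "r *\<^sub>R (a *\<^sub>C x) = a *\<^sub>C (r *\<^sub>R x)"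
  by (simp add: scaleR_scaleC scaleC_scaleC mult.commute)

lemma norm_scaleC: "norm (a *\<^sub>C x) = cmod a * norm x"
proof -
  have "complex_of_real ((norm (a *\<^sub>C x))\<^sup>2) = (a * cnj a) * cinner x x"
    unfolding cinner_self[symmetric] by (simp add: cinner_scaleC_left cinner_scaleC_right)
  also have "\<dots> = complex_of_real ((cmod a * norm x)\<^sup>2)"
    unfolding complex_norm_square[symmetric] cinner_self by (simp add: power_mult_distrib)
  finally show ?thesis
    unfolding of_real_eq_iff by (rule power2_eq_imp_eq) auto
qed

text \<open>Rotating \<open>x\<close> by a unit phase makes the form real and nonnegative without
  changing norms; the real Cauchy-Schwarz inequality then applies.\<close>

lemma cmod_cinner_le: "cmod (cinner x y) \<le> norm x * norm y"
proof -
  define u where "u = cis (- Arg (cinner x y))"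
  have "u * cinner x y = u * rcis (cmod (cinner x y)) (Arg (cinner x y))"
    by (simp only: rcis_cmod_Arg)
  also have "\<dots> = complex_of_real (cmod (cinner x y))"
    by (simp add: u_def rcis_def cis_mult)
  finally have "cmod (cinner x y) = inner (u *\<^sub>C x) y"
    by (simp add: inner_eq_Re_cinner cinner_scaleC_left)
  also have "\<dots> \<le> norm (u *\<^sub>C x) * norm y"
    by (rule norm_cauchy_schwarz)
  finally show ?thesis
    by (simp add: u_def norm_scaleC)
qed

lemma bounded_linear_scaleC: "bounded_linear (\<lambda>x. a *\<^sub>C x)"
  by (intro bounded_linear_intro[where K = "cmod a"])
     (simp_all add: scaleC_add_right scaleC_scaleR norm_scaleC)

lemma bounded_linear_scaleC_left: "bounded_linear (\<lambda>a. a *\<^sub>C x)"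
  by (intro bounded_linear_intro[where K = "norm x"])
     (simp_all add: scaleC_add_left scaleC_scaleC norm_scaleC scaleR_scaleC scaleR_conv_of_real)

lemma bounded_linear_cinner_left: "bounded_linear (\<lambda>x. cinner x y)"
  by (intro bounded_linear_intro[where K = "norm y"])
     (simp_all add: cinner_add_left scaleR_scaleC cinner_scaleC_left cmod_cinner_le scaleR_conv_of_real)

lemma bounded_linear_cinner_right: "bounded_linear (\<lambda>y. cinner x y)"
  by (intro bounded_linear_intro[where K = "norm x"])
     (simp_all add: cinner_add_right scaleR_scaleC cinner_scaleC_right scaleR_conv_of_real
        cmod_cinner_le[of x, unfolded mult.commute[of "norm x"]])

lemmas cinner_zero_left [simp] = linear_0[OF bounded_linear.linear[OF bounded_linear_cinner_left]]
lemmas cinner_zero_right [simp] = linear_0[OF bounded_linear.linear[OF bounded_linear_cinner_right]]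
lemmas cinner_diff_left = linear_diff[OF bounded_linear.linear[OF bounded_linear_cinner_left]]
lemmas cinner_diff_right = linear_diff[OF bounded_linear.linear[OF bounded_linear_cinner_right]]
lemmas cinner_sum_left = linear_sum[OF bounded_linear.linear[OF bounded_linear_cinner_left]]
lemmas cinner_sum_right = linear_sum[OF bounded_linear.linear[OF bounded_linear_cinner_right]]
lemmas scaleC_zero_left [simp] = linear_0[OF bounded_linear.linear[OF bounded_linear_scaleC_left]]
lemmas scaleC_zero_right [simp] = linear_0[OF bounded_linear.linear[OF bounded_linear_scaleC]]

lemma scaleC_one [simp]: "1 *\<^sub>C x = x"
  using scaleR_scaleC[of 1 x] by simp

lemma csubspace_scaleC: "csubspace S \<Longrightarrow> x \<in> S \<Longrightarrow> c *\<^sub>C x \<in> S"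
  by (simp add: csubspace_def)

lemma bounded_clinear_imp_bounded_linear: "bounded_clinear A \<Longrightarrow> bounded_linear A"
  by (simp add: bounded_clinear_def)

lemma bounded_clinear_scaleC: "bounded_clinear A \<Longrightarrow> A (c *\<^sub>C x) = c *\<^sub>C A x"
  by (simp add: bounded_clinear_def)

text \<open>Polarization: norms of two vectors and of their sum fix the real inner product, and
  replacing \<open>x\<close> by \<open>\<i> *\<^sub>C x\<close> supplies the imaginary part. Since
  \<open>M\<close> is a subspace, these vectors stay where \<open>U\<close> preserves norms.\<close>

lemma isometric_on_cinner:
  assumes U: "isometric_on M U" and M: "csubspace M" and "x \<in> M" "y \<in> M"
  shows "cinner (U x) (U y) = cinner x y"
proof -
  have bl: "bounded_linear U" and n: "\<And>x. x \<in> M \<Longrightarrow> norm (U x) = norm x"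
    and sc: "\<And>c x. U (c *\<^sub>C x) = c *\<^sub>C U x"
    using U by (auto simp: isometric_on_def bounded_clinear_def)
  have inner: "inner (U u) (U v) = inner u v" if "u \<in> M" "v \<in> M" for u v
  proof -
    have "u + v \<in> M" using that M by (simp add: csubspace_def subspace_add)
    then have "norm (U u + U v) = norm (u + v)"
      using n[of "u + v"] by (simp add: linear_add bl bounded_linear.linear)
    then show ?thesis
      using n that by (simp add: dot_norm)
  qed
  have "inner (\<i> *\<^sub>C U x) (U y) = inner (\<i> *\<^sub>C x) y"
    using inner[of "\<i> *\<^sub>C x" y] assms by (simp add: sc csubspace_scaleC)
  then show ?thesis
    using inner[of x y] assms by (simp add: complex_eq_iff Im_cinner_eq_inner flip: inner_eq_Re_cinner)
qed

section \<open>Orthonormal families\<close>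

lemma orthonormal_familyD:
  "orthonormal_family N u \<Longrightarrow> m \<in> N \<Longrightarrow> n \<in> N \<Longrightarrow> cinner (u m) (u n) = (if m = n then 1 else 0)"
  by (simp add: orthonormal_family_def)

section \<open>Finite orthonormal sums and Bessel's inequality\<close>

lemma orthonormal_sum_cinner:
  assumes f: "orthonormal_family I f" and "finite F" "F \<subseteq> I" "n \<in> I"
  shows "cinner (\<Sum>k\<in>F. c k *\<^sub>C f k) (f n) = (if n \<in> F then c n else 0)"
proof -
  have "cinner (\<Sum>k\<in>F. c k *\<^sub>C f k) (f n) = (\<Sum>k\<in>F. if k = n then c k else 0)"
    unfolding cinner_sum_left
    by (rule sum.cong) (use assms in \<open>auto simp: cinner_scaleC_left orthonormal_familyD\<close>)
  then show ?thesis
    using assms by simp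
qed

lemma orthonormal_sum_norm:
  assumes f: "orthonormal_family I f" and F: "finite F" "F \<subseteq> I"
  shows "(norm (\<Sum>k\<in>F. c k *\<^sub>C f k))\<^sup>2 = (\<Sum>k\<in>F. (cmod (c k))\<^sup>2)"
proof -
  let ?p = "\<Sum>k\<in>F. c k *\<^sub>C f k"
  have "cinner ?p ?p = (\<Sum>k\<in>F. cnj (c k) * cinner ?p (f k))"
    by (simp add: cinner_sum_right[of ?p] cinner_scaleC_right)
  also have "\<dots> = (\<Sum>k\<in>F. complex_of_real ((cmod (c k))\<^sup>2))"
  proof (rule sum.cong[OF refl])
    fix k assume "k \<in> F"
    then show "cnj (c k) * cinner ?p (f k) = complex_of_real ((cmod (c k))\<^sup>2)"
      using orthonormal_sum_cinner[OF f F, of k c] F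
      by (subst complex_norm_square) (auto simp: mult.commute)
  qed
  finally show ?thesis
    unfolding cinner_self of_real_sum[symmetric] of_real_eq_iff .
qed

text \<open>The residual of \<open>x\<close> is orthogonal to its partial expansion
  \<open>p\<close>, so Pythagoras bounds the norm of \<open>p\<close> by that of
  \<open>x\<close>.\<close>

lemma bessel_finite:
  assumes f: "orthonormal_family I f" and F: "finite F" "F \<subseteq> I"
  shows "(\<Sum>k\<in>F. (cmod (cinner x (f k)))\<^sup>2) \<le> (norm x)\<^sup>2"
proof -
  define p where "p = (\<Sum>k\<in>F. cinner x (f k) *\<^sub>C f k)"
  have "cinner (x - p) (f k) = 0" if "k \<in> F" for k
    using orthonormal_sum_cinner[OF f F, of k] that F by (auto simp: p_def cinner_diff_left)
  then have "cinner (x - p) p = 0"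
    by (subst p_def) (simp add: cinner_sum_right cinner_scaleC_right)
  then have "orthogonal (x - p) p"
    by (simp add: orthogonal_def inner_eq_Re_cinner)
  then have "(norm x)\<^sup>2 = (norm (x - p))\<^sup>2 + (norm p)\<^sup>2"
    using norm_add_Pythagorean by fastforce
  then show ?thesis
    using orthonormal_sum_norm[OF f F, of "\<lambda>k. cinner x (f k)"] by (simp add: p_def)
qed

section \<open>Convergence and uniqueness of orthonormal expansions\<close>

lemma bessel_summable_on:
  assumes f: "orthonormal_family I f"
  shows "(\<lambda>k. (cmod (cinner x (f k)))\<^sup>2) summable_on I"
  by (rule nonneg_bounded_partial_sums_imp_summable_on[where C = "(norm x)\<^sup>2"])
     (auto intro!: eventually_finite_subsets_at_top_weakI bessel_finite[OF f])

text \<open>Riesz-Fischer: the squared distance between nested finite partial sums is a difference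
  of partial sums of the scalar series, so the vector sums form a Cauchy filter, which converges by
  completeness.\<close>

lemma orthonormal_summable_on:
  fixes f :: "nat \<Rightarrow> 'a::chilbert_space"
  assumes f: "orthonormal_family I f" and c: "(\<lambda>k. (cmod (c k))\<^sup>2) summable_on I"
  shows "(\<lambda>k. c k *\<^sub>C f k) summable_on I"
proof -
  let ?g = "\<lambda>k. (cmod (c k))\<^sup>2" and ?h = "\<lambda>k. c k *\<^sub>C f k"
  from c obtain L where L: "(sum ?g \<longlongrightarrow> L) (finite_subsets_at_top I)"
    unfolding summable_on_def has_sum_def by blast
  have "\<exists>P. eventually P (finite_subsets_at_top I) \<and>
          (\<forall>F F'. P F \<and> P F' \<longrightarrow> dist (sum ?h F) (sum ?h F') < e)" if "e > 0" for e
  proof -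
    \<comment> \<open>Two scalar sums within \<open>d\<close> of \<open>L\<close> differ by less
      than \<open>2 * d\<close>, the square of the distance \<open>e / 2\<close> allowed to the
      reference set \<open>G\<close>.\<close>
    define d where "d = (e / 2)\<^sup>2 / 2"
    have "d > 0" using that by (simp add: d_def)
    with L have "\<forall>\<^sub>F F in finite_subsets_at_top I. dist (sum ?g F) L < d"
      by (simp add: tendsto_iff)
    then obtain G where G: "finite G" "G \<subseteq> I"
      and GL: "\<And>F. finite F \<Longrightarrow> G \<subseteq> F \<Longrightarrow> F \<subseteq> I \<Longrightarrow> dist (sum ?g F) L < d"
      by (auto simp: eventually_finite_subsets_at_top)
    define P where "P F \<longleftrightarrow> finite F \<and> G \<subseteq> F \<and> F \<subseteq> I" for F
    have near: "dist (sum ?h F) (sum ?h G) < e / 2" if "P F" for F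
    proof -
      have F: "finite F" "G \<subseteq> F" "F \<subseteq> I" using that by (auto simp: P_def)
      have "(dist (sum ?h F) (sum ?h G))\<^sup>2 = (norm (sum ?h (F - G)))\<^sup>2"
        using F by (simp add: dist_norm sum_diff)
      also have "\<dots> = sum ?g (F - G)"
        using F by (intro orthonormal_sum_norm[OF f]) auto
      also have "\<dots> = sum ?g F - sum ?g G"
        using F by (simp add: sum_diff)
      also have "\<dots> < 2 * d"
        using GL[OF F] GL[OF G(1) order_refl G(2)] unfolding dist_real_def by linarith
      finally show ?thesis
        using \<open>e > 0\<close> by (intro power2_less_imp_less[of _ "e / 2"]) (auto simp: d_def)
    qed
    have "eventually P (finite_subsets_at_top I)"
      unfolding eventually_finite_subsets_at_top P_def using G by blast
    moreover have "dist (sum ?h F) (sum ?h F') < e" if "P F" "P F'" for F F'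
      using near[OF that(1)] near[OF that(2)] by (rule dist_triangle_half_l)
    ultimately show ?thesis by blast
  qed
  then have "cauchy_filter (filtermap (sum ?h) (finite_subsets_at_top I))"
    by (simp add: cauchy_filter_metric_filtermap)
  moreover have "complete (UNIV :: 'a set)"
    by (meson Cauchy_convergent UNIV_I complete_def convergent_def)
  ultimately obtain l where "(sum ?h \<longlongrightarrow> l) (finite_subsets_at_top I)"
    using complete_uniform[where S = "UNIV :: 'a set"] by (force simp add: filterlim_def)
  then show ?thesis
    unfolding summable_on_def has_sum_def by blast
qed

lemma has_sum_in_closed_csubspace:
  assumes "(f has_sum x) I" "csubspace S" "closed S" "\<And>n. n \<in> I \<Longrightarrow> f n \<in> S"
  shows "x \<in> S"
proof (rule Lim_in_closed_set)
  show "(sum f \<longlongrightarrow> x) (finite_subsets_at_top I)" using assms(1) by (simp add: has_sum_def)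
  show "\<forall>\<^sub>F F in finite_subsets_at_top I. sum f F \<in> S"
    using assms by (intro eventually_finite_subsets_at_top_weakI subspace_sum)
      (auto simp: csubspace_def)
qed (use assms in auto)

lemma has_sum_orthonormal_cinner:
  assumes f: "orthonormal_family I f" and x: "((\<lambda>k. c k *\<^sub>C f k) has_sum x) I" and n: "n \<in> I"
  shows "cinner x (f n) = c n"
proof -
  have "((\<lambda>k. cinner (c k *\<^sub>C f k) (f n)) has_sum cinner x (f n)) I"
    by (rule has_sum_bounded_linear[OF bounded_linear_cinner_left x])
  moreover have "((\<lambda>k. cinner (c k *\<^sub>C f k) (f n)) has_sum c n) I"
    by (rule has_sum_finite_neutralI[where B = "{n}"])
       (use n f in \<open>auto simp: cinner_scaleC_left orthonormal_familyD\<close>)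
  ultimately show ?thesis by (rule has_sum_unique)
qed

text \<open>Parseval, obtained by pairing the series termwise with its own sum: continuity of the
  inner product avoids passing to the limit in the norms of partial sums.\<close>

lemma has_sum_orthonormal_norm:
  assumes f: "orthonormal_family I f" and x: "((\<lambda>k. c k *\<^sub>C f k) has_sum x) I"
  shows "((\<lambda>k. (cmod (c k))\<^sup>2) has_sum (norm x)\<^sup>2) I"
proof -
  have "((\<lambda>k. inner (c k *\<^sub>C f k) x) has_sum inner x x) I"
    by (rule has_sum_bounded_linear[OF bounded_linear_inner_left x])
  moreover have "inner (c k *\<^sub>C f k) x = (cmod (c k))\<^sup>2" if "k \<in> I" for k
  proof -
    have "cinner (f k) x = cnj (c k)"
      using has_sum_orthonormal_cinner[OF f x that] cinner_commute by metis
    then have "cinner (c k *\<^sub>C f k) x = complex_of_real ((cmod (c k))\<^sup>2)"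
      by (simp only: cinner_scaleC_left complex_norm_square)
    then show ?thesis
      by (simp add: inner_eq_Re_cinner)
  qed
  ultimately show ?thesis
    unfolding dot_square_norm by (simp cong: has_sum_cong)
qed

section \<open>Orthonormal bases and projections\<close>

text \<open>Completeness is phrased as maximality within \<open>S\<close> instead of density of the
  span. Index sets inside the naturals cover finite bases as well as countably infinite
  ones.\<close>

definition orthonormal_basis :: "nat set \<Rightarrow> (nat \<Rightarrow> 'a::complex_inner) \<Rightarrow> 'a set \<Rightarrow> bool" where
  "orthonormal_basis I f S \<longleftrightarrow> orthonormal_family I f \<and> f ` I \<subseteq> S \<and>
     (\<forall>x\<in>S. (\<forall>n\<in>I. cinner x (f n) = 0) \<longrightarrow> x = 0)"

text \<open>Zorn's lemma yields a maximal orthonormal set. Its distinct members are at distance sqrt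
  2, so choosing a point of a countable dense set within 1/2 of each is injective, and the set is
  countable. Separability is asked of the ambient \<open>S\<close> so that the result applies to
  subspaces such as \<open>S \<inter> ortho_compl T\<close>.\<close>

lemma orthonormal_basis_exists:
  fixes M S :: "'a::complex_inner set"
  assumes M: "csubspace M" "M \<subseteq> S" and S: "separable_space (top_of_set S)"
  shows "\<exists>I f. orthonormal_basis I f M"
proof -
  define \<A> where "\<A> = {B. B \<subseteq> M \<and> (\<forall>x\<in>B. \<forall>y\<in>B. cinner x y = (if x = y then 1 else 0))}"
  have "\<exists>B\<in>\<A>. \<forall>X\<in>\<A>. B \<subseteq> X \<longrightarrow> X = B"
  proof (rule subset_Zorn')
    fix C assume C: "subset.chain \<A> C"
    show "\<Union>C \<in> \<A>"
      unfolding \<A>_def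
    proof (intro CollectI conjI ballI)
      show "\<Union>C \<subseteq> M" using C by (auto simp: subset_chain_def \<A>_def)
      fix x y assume "x \<in> \<Union>C" "y \<in> \<Union>C"
      then obtain Z where "Z \<in> C" "x \<in> Z" "y \<in> Z"
        using C unfolding subset_chain_def by blast
      then show "cinner x y = (if x = y then 1 else 0)"
        using C by (auto simp: subset_chain_def \<A>_def)
    qed
  qed
  then obtain B where BA: "B \<in> \<A>" and max: "\<And>X. X \<in> \<A> \<Longrightarrow> B \<subseteq> X \<Longrightarrow> X = B"
    by blast
  from BA have B: "B \<subseteq> M" "\<And>x y. x \<in> B \<Longrightarrow> y \<in> B \<Longrightarrow> cinner x y = (if x = y then 1 else 0)"
    unfolding \<A>_def by blast+
  obtain D where D: "countable D" "D \<subseteq> S" "S \<subseteq> closure D"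
    using S unfolding separable_space_def by (auto simp: closure_of_subtopology Int_absorb1)
  have "\<exists>d\<in>D. dist d b < 1 / 2" if "b \<in> B" for b
  proof -
    have "b \<in> closure D" using that B M D by blast
    then show ?thesis unfolding closure_approachable by (metis half_gt_zero_iff zero_less_one)
  qed
  then obtain d where d: "\<And>b. b \<in> B \<Longrightarrow> d b \<in> D \<and> dist (d b) b < 1 / 2" by metis
  have "inj_on d B"
  proof (rule inj_onI, rule ccontr)
    fix x y assume xy: "x \<in> B" "y \<in> B" "d x = d y" "x \<noteq> y"
    have "dist x y < 1"
      using d[of x] d[of y] xy dist_triangle_half_r[of "d x" x 1 y] by auto
    moreover have "(norm (x - y))\<^sup>2 = 2"
      unfolding power2_norm_eq_inner inner_eq_Re_cinner
      using xy B(2) by (simp add: cinner_diff_left cinner_diff_right)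
    moreover have "(norm (x - y))\<^sup>2 \<le> 1\<^sup>2" if "norm (x - y) \<le> 1"
      using that by (intro power_mono) auto
    ultimately show False by (auto simp: dist_norm)
  qed
  moreover have "countable (d ` B)"
    using D(1) d by (auto intro: countable_subset)
  ultimately have cB: "countable B" using countable_image_inj_on by blast
  \<comment> \<open>The index set is the range of a numbering of \<open>B\<close>, so a finite
    \<open>B\<close> receives a finite index set.\<close>
  define f where "f = from_nat_into B"
  define I where "I = to_nat_on B ` B"
  have fI: "f ` I = B" "inj_on f I"
    using cB by (auto simp: f_def I_def image_image inj_on_def)
  have "orthonormal_family I f"
    unfolding orthonormal_family_def
  proof (intro ballI)
    fix m n assume "m \<in> I" "n \<in> I"
    then show "cinner (f m) (f n) = (if m = n then 1 else 0)"
      using B(2)[of "f m" "f n"] fI inj_on_eq_iff[OF fI(2), of m n] by auto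
  qed
  moreover have "x = 0" if x: "x \<in> M" "\<And>n. n \<in> I \<Longrightarrow> cinner x (f n) = 0" for x
  proof (rule ccontr)
    assume "x \<noteq> 0"
    \<comment> \<open>The normalization of a nonzero vector orthogonal to \<open>B\<close> would
      enlarge the maximal set.\<close>
    define u where "u = (complex_of_real (inverse (norm x))) *\<^sub>C x"
    have xB: "cinner x b = 0" if "b \<in> B" for b
      using that x(2) fI(1) by auto
    have uB: "cinner u b = 0" "cinner b u = 0" if "b \<in> B" for b
      using xB[OF that] cinner_commute[of b x] by (simp_all add: u_def cinner_scaleC_left cinner_scaleC_right)
    have uu: "cinner u u = 1"
      using \<open>x \<noteq> 0\<close> by (simp add: u_def cinner_self norm_scaleC norm_inverse)
    have "u \<in> M" using M x by (simp add: u_def csubspace_scaleC)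
    have "u \<notin> B" using uB(1)[of u] uu by auto
    then have "insert u B \<in> \<A>"
      using B uu uB \<open>u \<in> M\<close> unfolding \<A>_def by (auto split: if_splits)
    then show False using max[of "insert u B"] \<open>u \<notin> B\<close> by auto
  qed
  ultimately have "orthonormal_basis I f M"
    using fI B by (auto simp: orthonormal_basis_def)
  then show ?thesis by blast
qed

lemma orthonormal_basis_finite_dimensional:
  fixes f :: "nat \<Rightarrow> 'a::complex_inner"
  assumes f: "orthonormal_basis I f S" and S: "csubspace S" and "finite I"
  shows "\<not> infinite_dimensional S"
proof -
  \<comment> \<open>\<open>span\<close> is the real span, so both \<open>f n\<close> and
    \<open>\<i> *\<^sub>C f n\<close> are needed to generate the complex multiples of
    \<open>f n\<close>.\<close>
  have "x \<in> span (f ` I \<union> (\<lambda>n. \<i> *\<^sub>C f n) ` I)" if x: "x \<in> S" for x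
  proof -
    define p where "p = (\<Sum>n\<in>I. cinner x (f n) *\<^sub>C f n)"
    have "p \<in> S"
      using f S by (auto simp: p_def orthonormal_basis_def csubspace_def intro!: subspace_sum)
    moreover have "cinner (x - p) (f n) = 0" if "n \<in> I" for n
      using orthonormal_sum_cinner[of I f I n] f that \<open>finite I\<close>
      by (simp add: p_def cinner_diff_left orthonormal_basis_def)
    ultimately have "x - p = 0"
      using f x S by (simp add: orthonormal_basis_def csubspace_def subspace_diff del: right_minus_eq)
    moreover have "c *\<^sub>C f n \<in> span (f ` I \<union> (\<lambda>n. \<i> *\<^sub>C f n) ` I)" if "n \<in> I" for c n
    proof -
      have "c *\<^sub>C f n = Re c *\<^sub>R f n + Im c *\<^sub>R (\<i> *\<^sub>C f n)"
        by (simp add: scaleR_scaleC scaleC_scaleC mult.commute flip: scaleC_add_left complex_eq)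
      moreover have "Re c *\<^sub>R f n + Im c *\<^sub>R (\<i> *\<^sub>C f n) \<in> span (f ` I \<union> (\<lambda>n. \<i> *\<^sub>C f n) ` I)"
        using that by (intro span_add span_scale span_base) auto
      ultimately show ?thesis by simp
    qed
    then have "p \<in> span (f ` I \<union> (\<lambda>n. \<i> *\<^sub>C f n) ` I)"
      unfolding p_def by (intro span_sum)
    ultimately show ?thesis by simp
  qed
  then show ?thesis
    unfolding infinite_dimensional_def using \<open>finite I\<close> by (metis finite_UnI finite_imageI subsetI)
qed

text \<open>Two candidates for the projection differ by a vector of \<open>S\<close> that is
  orthogonal to itself, so the definite description is met by any one decomposition.\<close>

lemma proj_eqI:
  assumes S: "csubspace S" and y: "y \<in> S" "x - y \<in> ortho_compl S"
  shows "proj S x = y"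
  unfolding proj_def
proof (rule the_equality)
  fix z assume z: "z \<in> S \<and> x - z \<in> ortho_compl S"
  have "z - y \<in> S"
    using y z S by (simp add: csubspace_def subspace_diff)
  then have "cinner (x - y) (z - y) = 0" "cinner (x - z) (z - y) = 0"
    using y z by (auto simp: ortho_compl_def)
  then have "cinner (z - y) (z - y) = 0"
    by (simp add: cinner_diff_left)
  then show "z = y"
    by (simp add: cinner_self_eq_0_iff)
qed (use y in auto)

text \<open>Existence of the projection: Bessel makes the Fourier series of \<open>x\<close>
  converge, and closedness keeps its sum in \<open>S\<close>.\<close>

lemma orthonormal_basis_has_sum_proj:
  fixes f :: "nat \<Rightarrow> 'a::chilbert_space"
  assumes f: "orthonormal_basis I f S" and S: "csubspace S" "closed S"
  shows "((\<lambda>n. cinner x (f n) *\<^sub>C f n) has_sum proj S x) I"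
    and "proj S x \<in> S" and "x - proj S x \<in> ortho_compl S"
proof -
  have on: "orthonormal_family I f" and fS: "\<And>n. n \<in> I \<Longrightarrow> f n \<in> S"
    and total: "\<And>x. x \<in> S \<Longrightarrow> (\<And>n. n \<in> I \<Longrightarrow> cinner x (f n) = 0) \<Longrightarrow> x = 0"
    using f by (auto simp: orthonormal_basis_def)
  have expand: "\<exists>p. ((\<lambda>n. cinner x (f n) *\<^sub>C f n) has_sum p) I \<and> p \<in> S \<and>
      (\<forall>n\<in>I. cinner (x - p) (f n) = 0)" for x
  proof -
    obtain p where p: "((\<lambda>n. cinner x (f n) *\<^sub>C f n) has_sum p) I"
      using orthonormal_summable_on[OF on bessel_summable_on[OF on]] by (auto simp: summable_on_def)
    moreover have "p \<in> S"
      by (rule has_sum_in_closed_csubspace[OF p S]) (use S fS in \<open>auto simp: csubspace_scaleC\<close>)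
    moreover have "\<forall>n\<in>I. cinner (x - p) (f n) = 0"
      using has_sum_orthonormal_cinner[OF on p] by (simp add: cinner_diff_left)
    ultimately show ?thesis by blast
  qed
  obtain p where p: "((\<lambda>n. cinner x (f n) *\<^sub>C f n) has_sum p) I" "p \<in> S"
    and px: "\<forall>n\<in>I. cinner (x - p) (f n) = 0"
    using expand by blast
  \<comment> \<open>Orthogonality to the basis vectors must be extended to all of \<open>S\<close>:
    each \<open>y\<close> in \<open>S\<close> equals its own expansion by totality, and the form is
    continuous.\<close>
  have "cinner (x - p) y = 0" if "y \<in> S" for y
  proof -
    obtain q where q: "((\<lambda>n. cinner y (f n) *\<^sub>C f n) has_sum q) I" "q \<in> S"
      "\<forall>n\<in>I. cinner (y - q) (f n) = 0"
      using expand by blast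
    have "y - q = 0"
      by (rule total) (use q that S in \<open>simp_all add: csubspace_def subspace_diff\<close>)
    then have y: "((\<lambda>n. cinner y (f n) *\<^sub>C f n) has_sum y) I"
      using q(1) by simp
    have "((\<lambda>n. cinner (x - p) (cinner y (f n) *\<^sub>C f n)) has_sum cinner (x - p) y) I"
      by (rule has_sum_bounded_linear[OF bounded_linear_cinner_right y])
    moreover have "((\<lambda>n. cinner (x - p) (cinner y (f n) *\<^sub>C f n)) has_sum 0) I"
      by (rule has_sum_0) (use px in \<open>simp add: cinner_scaleC_right\<close>)
    ultimately show ?thesis by (rule has_sum_unique)
  qed
  then have xp: "x - p \<in> ortho_compl S"
    by (simp add: ortho_compl_def)
  have "proj S x = p"
    by (rule proj_eqI[OF S(1) p(2) xp])
  then show "((\<lambda>n. cinner x (f n) *\<^sub>C f n) has_sum proj S x) I"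
    and "proj S x \<in> S" and "x - proj S x \<in> ortho_compl S"
    using p xp by auto
qed

lemma cinner_commute_eq_0: "cinner x y = 0 \<longleftrightarrow> cinner y x = 0"
  by (metis cinner_commute complex_cnj_zero)

text \<open>Separability is only assumed because the existence of \<^const>\<open>proj\<close> is derived from a
  countable orthonormal basis.\<close>

locale closed_separable_csubspace =
  fixes S :: "'a::chilbert_space set"
  assumes csubspace: "csubspace S" and closed: "closed S"
    and separable: "separable_space (top_of_set S)"
begin

lemma proj_in [simp]: "proj S x \<in> S" and diff_proj: "x - proj S x \<in> ortho_compl S"
proof -
  obtain I f where "orthonormal_basis I f S"
    using orthonormal_basis_exists[OF csubspace order_refl separable] by blast
  from orthonormal_basis_has_sum_proj(2,3)[OF this csubspace closed]
  show "proj S x \<in> S" "x - proj S x \<in> ortho_compl S" by auto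
qed

lemma cinner_proj_left: "y \<in> S \<Longrightarrow> cinner (proj S x) y = cinner x y"
  using diff_proj[of x] by (auto simp: ortho_compl_def cinner_diff_left)

lemma proj_eq_0_iff: "proj S x = 0 \<longleftrightarrow> x \<in> ortho_compl S"
proof
  assume "proj S x = 0"
  then show "x \<in> ortho_compl S" using diff_proj[of x] by simp
next
  assume "x \<in> ortho_compl S"
  then show "proj S x = 0"
    using csubspace by (intro proj_eqI[OF csubspace]) (auto simp: csubspace_def subspace_0)
qed

lemma proj_eq_self: "x \<in> S \<Longrightarrow> proj S x = x"
  by (rule proj_eqI[OF csubspace]) (auto simp: ortho_compl_def)

lemma proj_zero: "proj S 0 = 0"
  using csubspace by (intro proj_eq_self) (simp add: csubspace_def subspace_0)

lemma bounded_clinear_proj: "bounded_clinear (proj S)"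
  unfolding bounded_clinear_def
proof (intro conjI allI bounded_linear_intro[where K = 1])
  show scaleC: "proj S (c *\<^sub>C x) = c *\<^sub>C proj S x" for c x
  proof (rule proj_eqI[OF csubspace])
    show "c *\<^sub>C proj S x \<in> S"
      by (simp add: csubspace_scaleC csubspace)
    show "c *\<^sub>C x - c *\<^sub>C proj S x \<in> ortho_compl S"
      by (auto simp: ortho_compl_def cinner_diff_left cinner_scaleC_left cinner_proj_left)
  qed
  show "proj S (x + y) = proj S x + proj S y" for x y
  proof (rule proj_eqI[OF csubspace])
    show "proj S x + proj S y \<in> S"
      using csubspace by (simp add: csubspace_def subspace_add)
    show "x + y - (proj S x + proj S y) \<in> ortho_compl S"
      by (auto simp: ortho_compl_def cinner_diff_left cinner_add_left cinner_proj_left)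
  qed
  show "proj S (r *\<^sub>R x) = r *\<^sub>R proj S x" for r x
    by (simp add: scaleR_scaleC scaleC)
  show "norm (proj S x) \<le> norm x * 1" for x
  proof (rule power2_le_imp_le)
    have "orthogonal (x - proj S x) (proj S x)"
      by (simp add: orthogonal_def inner_eq_Re_cinner cinner_diff_left cinner_proj_left)
    from norm_add_Pythagorean[OF this]
    show "(norm (proj S x))\<^sup>2 \<le> (norm x * 1)\<^sup>2" by simp
  qed simp
qed

end

section \<open>Isometries on coordinate subspaces of \<open>\<ell>\<^sup>2\<close>\<close>

lemma cinner_ell2_basis: "cinner x (ell2_basis n) = ell2_nth x n"
proof -
  have "(\<lambda>k. ell2_nth x k * cnj (ell2_nth (ell2_basis n) k)) = (\<lambda>k. if k = n then ell2_nth x k else 0)"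
    by (auto simp: ell2_basis.rep_eq)
  then show ?thesis
    using sums_single[of n "ell2_nth x"] by (simp add: cinner_ell2_def sums_iff)
qed

lemma ell2_nth_basis: "ell2_nth (ell2_basis m) n = (if n = m then 1 else 0)"
  by (simp add: ell2_basis.rep_eq)

lemma ell2_eqI: "(\<And>n. ell2_nth x n = ell2_nth y n) \<Longrightarrow> x = y"
  by (simp add: ell2_nth_inject[symmetric] ext)

lemma orthonormal_basis_ell2: "orthonormal_basis UNIV ell2_basis UNIV"
  unfolding orthonormal_basis_def orthonormal_family_def cinner_ell2_basis
  by (auto simp: ell2_nth_basis zero_ell2.rep_eq intro: ell2_eqI)

lemma has_sum_ell2: "((\<lambda>n. ell2_nth x n *\<^sub>C ell2_basis n) has_sum x) UNIV"
proof -
  have C: "csubspace (UNIV :: ell2 set)"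
    by (simp add: csubspace_def)
  \<comment> \<open>The residual of a projection onto the whole space is orthogonal to everything,
    itself included.\<close>
  have "proj UNIV x = x"
    using orthonormal_basis_has_sum_proj(3)[OF orthonormal_basis_ell2 C, of x]
    by (auto simp: ortho_compl_def dest: spec[of _ "x - proj UNIV x"] simp: cinner_self_eq_0_iff)
  then show ?thesis
    using orthonormal_basis_has_sum_proj(1)[OF orthonormal_basis_ell2 C, of x]
    by (simp add: cinner_ell2_basis)
qed

lemma ell2_summable_on: "(\<lambda>n. (cmod (ell2_nth x n))\<^sup>2) summable_on A"
proof -
  have "(\<lambda>n. (cmod (ell2_nth x n))\<^sup>2) summable_on UNIV"
    using sums_nonneg_imp_has_sum[OF summable_sums[OF ell2_summable]] by (auto simp: summable_on_def)
  then show ?thesis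
    by (rule summable_on_subset_banach) simp
qed

lemma ell2_norm_sq_has_sum: "((\<lambda>n. (cmod (ell2_nth x n))\<^sup>2) has_sum (norm x)\<^sup>2) UNIV"
  unfolding ell2_norm_sq
  by (rule sums_nonneg_imp_has_sum[OF summable_sums[OF ell2_summable]]) simp

lemma csubspace_ell2_on: "csubspace (ell2_on I)"
  by (auto simp: csubspace_def subspace_def ell2_on_def scaleR_scaleC zero_ell2.rep_eq
      plus_ell2.rep_eq scaleC_ell2.rep_eq)

lemma ell2_basis_in_ell2_on: "n \<in> I \<Longrightarrow> ell2_basis n \<in> ell2_on I"
  by (auto simp: ell2_on_def ell2_nth_basis)

text \<open>For \<open>I = UNIV\<close> the vanishing condition concerns only the zero vector and
  holds by linearity. Statements about plain isometries thereby become instances of those about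
  coordinate isometries.\<close>

lemma coord_isometry_UNIV: "coord_isometry UNIV X \<longleftrightarrow> isometry X"
proof -
  have "X x = 0" if "isometry X" "x \<in> ell2_on {}" for x
  proof -
    have "x = 0" using that by (auto simp: ell2_on_def zero_ell2.rep_eq intro: ell2_eqI)
    then show ?thesis
      using that by (simp add: isometric_on_def bounded_clinear_def linear_0 bounded_linear.linear)
  qed
  moreover have "ell2_on UNIV = UNIV"
    by (simp add: ell2_on_def)
  ultimately show ?thesis
    by (auto simp: coord_isometry_def)
qed

section \<open>Coordinate isometries, orthonormal bases and adjoints\<close>

lemma coord_isometry_bounded_clinear: "coord_isometry I X \<Longrightarrow> bounded_clinear X"
  by (simp add: coord_isometry_def isometric_on_def)

lemma coord_isometry_orthonormal:
  assumes X: "coord_isometry I X"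
  shows "orthonormal_family I (\<lambda>n. X (ell2_basis n))"
proof -
  have "cinner (X (ell2_basis m)) (X (ell2_basis n)) = (if m = n then 1 else 0)"
    if "m \<in> I" "n \<in> I" for m n
    using isometric_on_cinner[of "ell2_on I" X "ell2_basis m" "ell2_basis n"] X that
    by (simp add: coord_isometry_def csubspace_ell2_on ell2_basis_in_ell2_on cinner_ell2_basis ell2_nth_basis)
  then show ?thesis
    by (simp add: orthonormal_family_def)
qed

lemma coord_isometry_basis_outside:
  "coord_isometry I X \<Longrightarrow> n \<notin> I \<Longrightarrow> X (ell2_basis n) = 0"
  by (simp add: coord_isometry_def ell2_basis_in_ell2_on)

lemma bounded_clinear_ell2_has_sum:
  assumes "bounded_clinear X"
  shows "((\<lambda>n. ell2_nth x n *\<^sub>C X (ell2_basis n)) has_sum X x) UNIV"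
  using has_sum_bounded_linear[OF bounded_clinear_imp_bounded_linear[OF assms] has_sum_ell2[of x]]
  by (simp add: bounded_clinear_scaleC[OF assms])

text \<open>Since \<open>X\<close> kills the basis vectors outside \<open>I\<close>, a vector
  \<open>X u\<close> orthogonal to the family is orthogonal to every term of its own expansion,
  hence to itself.\<close>

lemma coord_isometry_orthonormal_basis:
  assumes X: "coord_isometry I X"
  shows "orthonormal_basis I (\<lambda>n. X (ell2_basis n)) (range X)"
proof -
  have "X u = 0" if u: "\<And>n. n \<in> I \<Longrightarrow> cinner (X u) (X (ell2_basis n)) = 0" for u
  proof -
    have z: "cinner (X u) (X (ell2_basis n)) = 0" for n
      by (cases "n \<in> I") (simp_all add: u coord_isometry_basis_outside[OF X])
    have "((\<lambda>n. cinner (X u) (ell2_nth u n *\<^sub>C X (ell2_basis n))) has_sum cinner (X u) (X u)) UNIV"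
      by (intro has_sum_bounded_linear[OF bounded_linear_cinner_right]
          bounded_clinear_ell2_has_sum coord_isometry_bounded_clinear[OF X])
    moreover have "((\<lambda>n. cinner (X u) (ell2_nth u n *\<^sub>C X (ell2_basis n))) has_sum 0) UNIV"
      by (rule has_sum_0) (simp add: cinner_scaleC_right z)
    ultimately have "cinner (X u) (X u) = 0" by (rule has_sum_unique)
    then show ?thesis by (simp add: cinner_self_eq_0_iff)
  qed
  then show ?thesis
    unfolding orthonormal_basis_def using coord_isometry_orthonormal[OF X] by auto
qed

text \<open>The synthesis map sums \<open>f\<close> with the coordinates in \<open>I\<close> as
  coefficients. Parseval makes it isometric on \<open>ell2_on I\<close>, and the Fourier
  coefficients of a vector of \<open>S\<close> provide a preimage.\<close>

lemma coord_isometry_exists: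
  fixes f :: "nat \<Rightarrow> 'a::chilbert_space"
  assumes f: "orthonormal_basis I f S" and S: "csubspace S" "closed S"
  shows "\<exists>X. coord_isometry I X \<and> range X = S \<and> (\<forall>n\<in>I. X (ell2_basis n) = f n)"
proof -
  have on: "orthonormal_family I f" and fS: "\<And>n. n \<in> I \<Longrightarrow> f n \<in> S"
    and total: "\<And>x. x \<in> S \<Longrightarrow> (\<And>n. n \<in> I \<Longrightarrow> cinner x (f n) = 0) \<Longrightarrow> x = 0"
    using f by (auto simp: orthonormal_basis_def)
  define X where "X x = infsum (\<lambda>n. ell2_nth x n *\<^sub>C f n) I" for x
  have X: "((\<lambda>n. ell2_nth x n *\<^sub>C f n) has_sum X x) I" for x
    unfolding X_def by (intro has_sum_infsum orthonormal_summable_on[OF on] ell2_summable_on)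
  have X_eqI: "X x = y" if "((\<lambda>n. ell2_nth x n *\<^sub>C f n) has_sum y) I" for x y
    using X that by (rule has_sum_unique)
  have sc: "X (c *\<^sub>C x) = c *\<^sub>C X x" for c x
    using has_sum_bounded_linear[OF bounded_linear_scaleC[of c] X[of x]]
    by (intro X_eqI) (simp add: scaleC_ell2.rep_eq scaleC_scaleC)
  have norm_X: "((\<lambda>n. (cmod (ell2_nth x n))\<^sup>2) has_sum (norm (X x))\<^sup>2) I" for x
    by (rule has_sum_orthonormal_norm[OF on X])
  have bcl: "bounded_clinear X"
    unfolding bounded_clinear_def
  proof (intro conjI allI sc bounded_linear_intro[where K = 1])
    show "X (x + y) = X x + X y" for x y
      using has_sum_add[OF X[of x] X[of y]]
      by (intro X_eqI) (simp add: plus_ell2.rep_eq scaleC_add_left)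
    show "X (r *\<^sub>R x) = r *\<^sub>R X x" for r x
      by (simp add: scaleR_scaleC sc)
    show "norm (X x) \<le> norm x * 1" for x
    proof (rule power2_le_imp_le)
      show "(norm (X x))\<^sup>2 \<le> (norm x * 1)\<^sup>2"
        using has_sum_mono2[OF norm_X[of x] ell2_norm_sq_has_sum[of x]] by simp
    qed simp
  qed
  have "norm (X x) = norm x" if "x \<in> ell2_on I" for x
  proof -
    have "((\<lambda>n. (cmod (ell2_nth x n))\<^sup>2) has_sum (norm x)\<^sup>2) I"
      using ell2_norm_sq_has_sum[of x] that
      by (subst has_sum_cong_neutral[where T = UNIV and g = "\<lambda>n. (cmod (ell2_nth x n))\<^sup>2"])
         (auto simp: ell2_on_def)
    from has_sum_unique[OF norm_X this] show ?thesis
      by simp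
  qed
  moreover have "X x = 0" if "x \<in> ell2_on (- I)" for x
    by (intro X_eqI has_sum_0) (use that in \<open>auto simp: ell2_on_def\<close>)
  ultimately have "coord_isometry I X"
    using bcl by (simp add: coord_isometry_def isometric_on_def)
  moreover have "X (ell2_basis n) = f n" if "n \<in> I" for n
    by (rule X_eqI, rule has_sum_finite_neutralI[where B = "{n}"])
       (use that in \<open>auto simp: ell2_nth_basis\<close>)
  moreover have "range X = S"
  proof (intro equalityI subsetI)
    fix y assume "y \<in> range X"
    then show "y \<in> S"
      using has_sum_in_closed_csubspace[OF X S] fS S by (auto simp: csubspace_scaleC)
  next
    fix y assume y: "y \<in> S"
    \<comment> \<open>Padding with zeros outside \<open>I\<close> reduces square summability over
      all indices to Bessel's inequality over \<open>I\<close>.\<close>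
    define u where "u n = (if n \<in> I then cinner y (f n) else 0)" for n
    have "(\<lambda>n. (cmod (u n))\<^sup>2) summable_on UNIV"
      using bessel_summable_on[OF on, of y]
      by (subst summable_on_cong_neutral[where T = I and g = "\<lambda>n. (cmod (cinner y (f n)))\<^sup>2"])
         (auto simp: u_def)
    then have u: "ell2_nth (Abs_ell2 u) = u"
      by (intro Abs_ell2_inverse) (simp add: summable_on_imp_summable)
    have "y - X (Abs_ell2 u) = 0"
    proof (rule total)
      have "X (Abs_ell2 u) \<in> S"
        using has_sum_in_closed_csubspace[OF X S] fS S by (auto simp: csubspace_scaleC)
      then show "y - X (Abs_ell2 u) \<in> S"
        using y S by (simp add: csubspace_def subspace_diff)
      show "cinner (y - X (Abs_ell2 u)) (f n) = 0" if "n \<in> I" for n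
        using has_sum_orthonormal_cinner[OF on X that, of "Abs_ell2 u"] that
        by (simp add: cinner_diff_left u u_def)
    qed
    then show "y \<in> range X" by simp
  qed
  ultimately show ?thesis by blast
qed

text \<open>\<open>cadjoint\<close> is a choice, so some adjoint has to be exhibited: send
  \<open>y\<close> to its sequence of coefficients against the vectors
  \<open>X (ell2_basis n)\<close>, which is square summable by Bessel.\<close>

lemma coord_isometry_cinner_cadjoint:
  fixes X :: "ell2 \<Rightarrow> 'a::chilbert_space"
  assumes X: "coord_isometry I X"
  shows "cinner (X x) y = cinner x (cadjoint X y)"
proof -
  have "\<exists>b. \<forall>x. cinner (X x) y = cinner x b" for y
  proof -
    define u where "u n = cinner y (X (ell2_basis n))" for n
    have "(\<lambda>n. (cmod (u n))\<^sup>2) summable_on UNIV"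
      using bessel_summable_on[OF coord_isometry_orthonormal[OF X], of y]
      by (subst summable_on_cong_neutral[where T = I and g = "\<lambda>n. (cmod (u n))\<^sup>2"])
         (auto simp: u_def coord_isometry_basis_outside[OF X])
    then have u: "ell2_nth (Abs_ell2 u) = u"
      by (intro Abs_ell2_inverse) (simp add: summable_on_imp_summable)
    have "cinner (X x) y = cinner x (Abs_ell2 u)" for x
    proof -
      have "(\<lambda>n. cinner (ell2_nth x n *\<^sub>C X (ell2_basis n)) y) sums cinner (X x) y"
        by (intro has_sum_imp_sums has_sum_bounded_linear[OF bounded_linear_cinner_left]
            bounded_clinear_ell2_has_sum coord_isometry_bounded_clinear[OF X])
      moreover have "cinner (ell2_nth x n *\<^sub>C X (ell2_basis n)) y = ell2_nth x n * cnj (u n)" for n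
        using cinner_commute[of "X (ell2_basis n)" y] by (simp add: cinner_scaleC_left u_def)
      ultimately show ?thesis
        by (simp add: cinner_ell2_def u sums_iff)
    qed
    then show ?thesis by blast
  qed
  then have "\<exists>B. \<forall>x y. cinner (X x) y = cinner x (B y)"
    by metis
  then show ?thesis
    unfolding cadjoint_def by (rule someI2_ex) blast
qed

section \<open>From diagonal matrices to biorthogonal bases\<close>

lemma matrix_entry_cadjoint:
  assumes X: "coord_isometry I X"
  shows "matrix_entry (cadjoint X \<circ> Y) i j = cinner (Y (ell2_basis j)) (X (ell2_basis i))"
  using coord_isometry_cinner_cadjoint[OF X, of "ell2_basis i" "Y (ell2_basis j)"]
  by (simp add: matrix_entry_def) (metis cinner_commute)

text \<open>The basis form of a pair of isometries with diagonal matrix;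
  \<open>cinner (g j) (f i)\<close> is the entry in row \<open>i\<close> and column
  \<open>j\<close>. An index in only one of \<open>I\<close> and \<open>J\<close> has no diagonal
  partner, so its vector is orthogonal to the entire other family.\<close>

definition biorthogonal_bases ::
  "nat set \<Rightarrow> nat set \<Rightarrow> (nat \<Rightarrow> 'a) \<Rightarrow> (nat \<Rightarrow> 'a) \<Rightarrow> 'a::complex_inner set \<Rightarrow> 'a set \<Rightarrow> bool" where
  "biorthogonal_bases I J f g S T \<longleftrightarrow> orthonormal_basis I f S \<and> orthonormal_basis J g T \<and>
     (\<forall>i\<in>I. \<forall>j\<in>J. i \<noteq> j \<longrightarrow> cinner (g j) (f i) = 0)"

lemma diagonal_isometries_iff_biorthogonal_bases:
  fixes S T :: "'a::chilbert_space set"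
  assumes S: "csubspace S" "closed S" and T: "csubspace T" "closed T"
  shows "(\<exists>X Y. coord_isometry I X \<and> coord_isometry J Y \<and> range X = S \<and> range Y = T \<and>
             diagonal_matrix (cadjoint X \<circ> Y)) \<longleftrightarrow> (\<exists>f g. biorthogonal_bases I J f g S T)"
proof
  assume "\<exists>X Y. coord_isometry I X \<and> coord_isometry J Y \<and> range X = S \<and> range Y = T \<and>
             diagonal_matrix (cadjoint X \<circ> Y)"
  then obtain X Y where X: "coord_isometry I X" "range X = S" and Y: "coord_isometry J Y" "range Y = T"
    and D: "diagonal_matrix (cadjoint X \<circ> Y)"
    by blast
  have "biorthogonal_bases I J (\<lambda>n. X (ell2_basis n)) (\<lambda>n. Y (ell2_basis n)) S T"
    using D coord_isometry_orthonormal_basis[OF X(1)] coord_isometry_orthonormal_basis[OF Y(1)] X(2) Y(2)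
    by (simp add: biorthogonal_bases_def diagonal_matrix_def matrix_entry_cadjoint[OF X(1)])
  then show "\<exists>f g. biorthogonal_bases I J f g S T" by blast
next
  assume "\<exists>f g. biorthogonal_bases I J f g S T"
  then obtain f g where f: "orthonormal_basis I f S" and g: "orthonormal_basis J g T"
    and fg: "\<And>i j. i \<in> I \<Longrightarrow> j \<in> J \<Longrightarrow> i \<noteq> j \<Longrightarrow> cinner (g j) (f i) = 0"
    by (auto simp: biorthogonal_bases_def)
  obtain X where X: "coord_isometry I X" "range X = S" "\<And>n. n \<in> I \<Longrightarrow> X (ell2_basis n) = f n"
    using coord_isometry_exists[OF f S] by blast
  obtain Y where Y: "coord_isometry J Y" "range Y = T" "\<And>n. n \<in> J \<Longrightarrow> Y (ell2_basis n) = g n"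
    using coord_isometry_exists[OF g T] by blast
  \<comment> \<open>Rows outside \<open>I\<close> and columns outside \<open>J\<close> vanish
    because the isometries are zero there.\<close>
  have "cinner (Y (ell2_basis j)) (X (ell2_basis i)) = 0" if "i \<noteq> j" for i j
    by (cases "i \<in> I"; cases "j \<in> J")
       (use that in \<open>simp_all add: X Y fg coord_isometry_basis_outside[OF X(1)]
          coord_isometry_basis_outside[OF Y(1)]\<close>)
  then have "diagonal_matrix (cadjoint X \<circ> Y)"
    by (simp add: diagonal_matrix_def matrix_entry_cadjoint[OF X(1)])
  then show "\<exists>X Y. coord_isometry I X \<and> coord_isometry J Y \<and> range X = S \<and> range Y = T \<and>
             diagonal_matrix (cadjoint X \<circ> Y)"
    using X Y by blast
qed

section \<open>Singular vectors of a product of two projections\<close>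

lemma S_decomposable_of_biorthogonal_bases:
  fixes S T :: "'a::chilbert_space set"
  assumes S: "closed_separable_csubspace S" and T: "closed_separable_csubspace T"
    and fg: "biorthogonal_bases I J f g S T"
  shows "S_decomposable (proj S \<circ> proj T)"
proof -
  interpret S: closed_separable_csubspace S by (rule S)
  interpret T: closed_separable_csubspace T by (rule T)
  have f: "orthonormal_basis I f S" and g: "orthonormal_basis J g T"
    and off: "\<And>i j. i \<in> I \<Longrightarrow> j \<in> J \<Longrightarrow> i \<noteq> j \<Longrightarrow> cinner (g j) (f i) = 0"
    using fg by (auto simp: biorthogonal_bases_def)
  have onf: "orthonormal_family I f" and ong: "orthonormal_family J g"
    using f g by (auto simp: orthonormal_basis_def)
  define d where "d n = cinner (g n) (f n)" for n
  \<comment> \<open>Singular values must be positive, so only indices with a nonzero diagonal entry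
    survive.\<close>
  define N where "N = {n \<in> I \<inter> J. d n \<noteq> 0}"
  \<comment> \<open>The phase of \<open>d n\<close> moves into the left singular vector, leaving its
    modulus as singular value.\<close>
  define \<psi> where "\<psi> n = sgn (d n) *\<^sub>C f n" for n
  \<comment> \<open>Biorthogonality leaves at most the term \<open>i = j\<close> in the expansion of
    \<open>proj S (g j)\<close>.\<close>
  have proj_g: "proj S (g j) = (if j \<in> N then d j *\<^sub>C f j else 0)" if j: "j \<in> J" for j
  proof -
    have "((\<lambda>i. cinner (g j) (f i) *\<^sub>C f i) has_sum proj S (g j)) I"
      by (rule orthonormal_basis_has_sum_proj(1)[OF f S.csubspace S.closed])
    moreover have "((\<lambda>i. cinner (g j) (f i) *\<^sub>C f i) has_sum (if j \<in> N then d j *\<^sub>C f j else 0)) I"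
    proof (rule has_sum_finite_neutralI[where B = "{j} \<inter> N"])
      fix i assume i: "i \<in> I - {j} \<inter> N"
      then have "cinner (g j) (f i) = 0"
        using off[of i j] j by (cases "i = j") (auto simp: N_def d_def)
      then show "cinner (g j) (f i) *\<^sub>C f i = 0"
        by simp
    qed (auto simp: N_def d_def)
    ultimately show ?thesis by (rule has_sum_unique)
  qed
  have bcl: "bounded_clinear (proj S \<circ> proj T)"
    using bounded_linear_compose[of "proj S" "proj T"] S.bounded_clinear_proj T.bounded_clinear_proj
    by (auto simp: bounded_clinear_def o_def)
  have "orthonormal_family N g"
    using ong by (auto simp: orthonormal_family_def N_def)
  moreover have "orthonormal_family N \<psi>"
  proof -
    have "cnj (sgn z) * sgn z = 1" if "z \<noteq> 0" for z :: complex
      using that complex_norm_square[of "sgn z"] by (simp add: norm_sgn mult.commute)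
    then show ?thesis
      using onf by (auto simp: orthonormal_family_def N_def \<psi>_def cinner_scaleC_left cinner_scaleC_right)
  qed
  moreover have "((\<lambda>n. (complex_of_real (cmod (d n)) * cinner x (g n)) *\<^sub>C \<psi> n)
      has_sum (proj S \<circ> proj T) x) N" for x
  proof -
    have "((\<lambda>j. cinner x (g j) *\<^sub>C g j) has_sum proj T x) J"
      by (rule orthonormal_basis_has_sum_proj(1)[OF g T.csubspace T.closed])
    then have "((\<lambda>j. proj S (cinner x (g j) *\<^sub>C g j)) has_sum proj S (proj T x)) J"
      by (rule has_sum_bounded_linear[OF bounded_clinear_imp_bounded_linear[OF S.bounded_clinear_proj]])
    then have *: "((\<lambda>j. cinner x (g j) *\<^sub>C proj S (g j)) has_sum proj S (proj T x)) J"
      by (simp add: bounded_clinear_scaleC[OF S.bounded_clinear_proj])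
    have "(complex_of_real (cmod (d n)) * cinner x (g n)) *\<^sub>C \<psi> n = cinner x (g n) *\<^sub>C d n *\<^sub>C f n" for n
    proof -
      have "complex_of_real (cmod (d n)) * cinner x (g n) * sgn (d n) = cinner x (g n) * d n"
        by (simp add: sgn_eq)
      then show ?thesis
        by (simp only: \<psi>_def scaleC_scaleC)
    qed
    then have "((\<lambda>n. (complex_of_real (cmod (d n)) * cinner x (g n)) *\<^sub>C \<psi> n) has_sum y) N \<longleftrightarrow>
        ((\<lambda>j. cinner x (g j) *\<^sub>C proj S (g j)) has_sum y) J" for y
      by (intro has_sum_cong_neutral) (auto simp: proj_g N_def)
    with * show ?thesis by simp
  qed
  moreover have "\<forall>n\<in>N. cmod (d n) > 0"
    by (simp add: N_def)
  ultimately show ?thesis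
    unfolding S_decomposable_def using bcl
    by (intro conjI exI[of _ N] exI[of _ "\<lambda>n. cmod (d n)"] exI[of _ g] exI[of _ \<psi>] allI)
qed

text \<open>All conclusions are read off from two facts about the decomposition: the coefficients of
  an image along the left vectors, and the image of each right vector.\<close>

lemma S_decomposable_proj_singular_vectors:
  fixes S T :: "'a::chilbert_space set"
  assumes S: "closed_separable_csubspace S" and T: "closed_separable_csubspace T"
    and "S_decomposable (proj S \<circ> proj T)"
  obtains N \<xi> \<psi> where "orthonormal_family N \<xi>" "orthonormal_family N \<psi>"
    "\<psi> ` N \<subseteq> S" "\<xi> ` N \<subseteq> T"
    "\<And>m n. m \<in> N \<Longrightarrow> n \<in> N \<Longrightarrow> m \<noteq> n \<Longrightarrow> cinner (\<xi> n) (\<psi> m) = 0"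
    "{x \<in> S. \<forall>n\<in>N. cinner x (\<psi> n) = 0} = S \<inter> ortho_compl T"
    "{x \<in> T. \<forall>n\<in>N. cinner x (\<xi> n) = 0} = T \<inter> ortho_compl S"
proof -
  interpret S: closed_separable_csubspace S by (rule S)
  interpret T: closed_separable_csubspace T by (rule T)
  obtain N s \<xi> \<psi> where "orthonormal_family N \<xi> \<and> orthonormal_family N \<psi> \<and> (\<forall>n\<in>N. s n > 0) \<and>
      (\<forall>x. ((\<lambda>n. (complex_of_real (s n) * cinner x (\<xi> n)) *\<^sub>C \<psi> n) has_sum (proj S \<circ> proj T) x) N)"
    using assms(3) unfolding S_decomposable_def by blast
  then have \<xi>: "orthonormal_family N \<xi>" and \<psi>: "orthonormal_family N \<psi>"
    and s: "\<And>n. n \<in> N \<Longrightarrow> s n > 0"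
    and svd: "\<And>x. ((\<lambda>n. (complex_of_real (s n) * cinner x (\<xi> n)) *\<^sub>C \<psi> n) has_sum proj S (proj T x)) N"
    by simp_all
  have coeff: "cinner (proj S (proj T x)) (\<psi> n) = complex_of_real (s n) * cinner x (\<xi> n)"
    if "n \<in> N" for x n
    by (rule has_sum_orthonormal_cinner[OF \<psi> svd that])
  have image: "proj S (proj T (\<xi> n)) = complex_of_real (s n) *\<^sub>C \<psi> n" if "n \<in> N" for n
  proof -
    have "((\<lambda>k. (complex_of_real (s k) * cinner (\<xi> n) (\<xi> k)) *\<^sub>C \<psi> k)
        has_sum complex_of_real (s n) *\<^sub>C \<psi> n) N"
      by (rule has_sum_finite_neutralI[where B = "{n}"])
         (use that \<xi> in \<open>auto simp: orthonormal_familyD\<close>)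
    with svd show ?thesis by (rule has_sum_unique)
  qed
  \<comment> \<open>Positivity of \<open>s n\<close> allows dividing the image of
    \<open>\<xi> n\<close>, which lies in \<open>S\<close>.\<close>
  have \<psi>S: "\<psi> n \<in> S" if "n \<in> N" for n
  proof -
    have "complex_of_real (inverse (s n)) *\<^sub>C proj S (proj T (\<xi> n)) = \<psi> n"
      using s[OF that] by (simp add: image[OF that] scaleC_scaleC)
    then show ?thesis
      by (metis S.csubspace S.proj_in csubspace_scaleC)
  qed
  have \<xi>T: "\<xi> n \<in> T" if "n \<in> N" for n
  proof -
    \<comment> \<open>The product of projections annihilates this residual, so its coefficient along
      \<open>\<xi> n\<close> vanishes; it is also orthogonal to \<open>T\<close>, hence to
      itself.\<close>
    let ?r = "\<xi> n - proj T (\<xi> n)"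
    have "proj T ?r = 0"
      using T.diff_proj by (simp add: T.proj_eq_0_iff)
    then have "cinner ?r (\<xi> n) = 0"
      using coeff[OF that, of ?r] s[OF that] S.proj_zero by simp
    moreover have "cinner ?r (proj T (\<xi> n)) = 0"
      using T.diff_proj[of "\<xi> n"] by (simp add: ortho_compl_def)
    ultimately have "cinner ?r ?r = 0"
      by (simp add: cinner_diff_right)
    then have "\<xi> n = proj T (\<xi> n)"
      by (simp add: cinner_self_eq_0_iff)
    then show ?thesis
      by (metis T.proj_in)
  qed
  have off: "cinner (\<xi> n) (\<psi> m) = 0" if "m \<in> N" "n \<in> N" "m \<noteq> n" for m n
  proof -
    \<comment> \<open>As \<open>\<xi> n\<close> is in \<open>T\<close> and \<open>\<psi> m\<close>
      in \<open>S\<close>, both projections can be inserted for free; the coefficient formula then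
      gives \<open>s m\<close> times \<open>cinner (\<xi> n) (\<xi> m)\<close>.\<close>
    have "cinner (\<xi> n) (\<psi> m) = cinner (proj S (proj T (\<xi> n))) (\<psi> m)"
      using that by (simp add: S.cinner_proj_left \<psi>S T.proj_eq_self \<xi>T)
    then show ?thesis
      using that \<xi> by (simp add: coeff orthonormal_familyD)
  qed
  \<comment> \<open>For \<open>y\<close> in \<open>T\<close> and \<open>x\<close> in
    \<open>S\<close>, the value \<open>cinner y x\<close> is unchanged when \<open>y\<close> is
    replaced by its image, a series in the \<open>\<psi> n\<close>. Conversely, \<open>s n\<close>
    times \<open>\<psi> n\<close> pairs with \<open>x\<close> exactly as \<open>\<xi> n\<close>
    does.\<close>
  have S0: "{x \<in> S. \<forall>n\<in>N. cinner x (\<psi> n) = 0} = S \<inter> ortho_compl T"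
  proof (intro equalityI subsetI IntI)
    fix x assume x: "x \<in> {x \<in> S. \<forall>n\<in>N. cinner x (\<psi> n) = 0}"
    then show "x \<in> S" by simp
    have "cinner y x = 0" if y: "y \<in> T" for y
    proof -
      have "((\<lambda>n. cinner ((complex_of_real (s n) * cinner y (\<xi> n)) *\<^sub>C \<psi> n) x)
          has_sum cinner (proj S (proj T y)) x) N"
        by (rule has_sum_bounded_linear[OF bounded_linear_cinner_left svd])
      moreover have "((\<lambda>n. cinner ((complex_of_real (s n) * cinner y (\<xi> n)) *\<^sub>C \<psi> n) x) has_sum 0) N"
        by (rule has_sum_0) (use x in \<open>auto simp: cinner_scaleC_left cinner_commute_eq_0[of _ x]\<close>)
      ultimately have "cinner (proj S (proj T y)) x = 0"
        by (rule has_sum_unique)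
      then show ?thesis
        using x y by (simp add: T.proj_eq_self S.cinner_proj_left)
    qed
    then show "x \<in> ortho_compl T"
      by (simp add: ortho_compl_def cinner_commute_eq_0[of x])
  next
    fix x assume x: "x \<in> S \<inter> ortho_compl T"
    have "cinner x (\<psi> n) = 0" if n: "n \<in> N" for n
    proof -
      have "cinner (complex_of_real (s n) *\<^sub>C \<psi> n) x = cinner (\<xi> n) x"
        using x n by (simp add: image[symmetric] S.cinner_proj_left T.proj_eq_self \<xi>T)
      also have "\<dots> = 0"
        using x n \<xi>T by (auto simp: ortho_compl_def cinner_commute_eq_0[of _ x])
      finally show ?thesis
        using s[OF n] by (simp add: cinner_scaleC_left cinner_commute_eq_0[of x])
    qed
    then show "x \<in> {x \<in> S. \<forall>n\<in>N. cinner x (\<psi> n) = 0}"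
      using x by simp
  qed
  \<comment> \<open>On \<open>T\<close> the operator is just \<open>proj S\<close>; its kernel is
    where all coefficients along the \<open>\<xi> n\<close> vanish.\<close>
  have T0: "{x \<in> T. \<forall>n\<in>N. cinner x (\<xi> n) = 0} = T \<inter> ortho_compl S"
  proof (intro equalityI subsetI IntI)
    fix x assume x: "x \<in> {x \<in> T. \<forall>n\<in>N. cinner x (\<xi> n) = 0}"
    then show "x \<in> T" by simp
    have "((\<lambda>n. (complex_of_real (s n) * cinner x (\<xi> n)) *\<^sub>C \<psi> n) has_sum 0) N"
      by (rule has_sum_0) (use x in simp)
    with svd have "proj S (proj T x) = 0" by (rule has_sum_unique)
    then show "x \<in> ortho_compl S"
      using x by (simp add: S.proj_eq_0_iff T.proj_eq_self)
  next
    fix x assume x: "x \<in> T \<inter> ortho_compl S"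
    then have "proj S (proj T x) = 0"
      by (simp add: S.proj_eq_0_iff T.proj_eq_self)
    then have "cinner x (\<xi> n) = 0" if "n \<in> N" for n
      using coeff[OF that, of x] s[OF that] by simp
    then show "x \<in> {x \<in> T. \<forall>n\<in>N. cinner x (\<xi> n) = 0}"
      using x by simp
  qed
  show thesis
    by (rule that[OF \<xi> \<psi> _ _ off S0 T0]) (use \<psi>S \<xi>T in auto)
qed

section \<open>Completing the singular vectors to biorthogonal bases\<close>

definition interleave :: "(nat \<Rightarrow> 'a) \<Rightarrow> (nat \<Rightarrow> 'a) \<Rightarrow> nat \<Rightarrow> 'a" where
  "interleave f g n = (if even n then f (n div 2) else g (n div 2))"

text \<open>Encodes the disjoint union of two index sets within the naturals: even positions are
  used for singular vectors, odd ones for the vectors completing them.\<close>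

definition interleave_set :: "nat set \<Rightarrow> nat set \<Rightarrow> nat set" where
  "interleave_set N A = {n. if even n then n div 2 \<in> N else n div 2 \<in> A}"

lemma orthonormal_basis_interleave:
  assumes f: "orthonormal_family N f" "f ` N \<subseteq> S"
    and g: "orthonormal_basis A g {x \<in> S. \<forall>n\<in>N. cinner x (f n) = 0}"
  shows "orthonormal_basis (interleave_set N A) (interleave f g) S"
proof -
  have gS: "g n \<in> S" and gf: "\<And>m. m \<in> N \<Longrightarrow> cinner (g n) (f m) = 0" if "n \<in> A" for n
    using g that by (auto simp: orthonormal_basis_def)
  have fg: "cinner (f m) (g n) = 0" if "n \<in> A" "m \<in> N" for m n
    using gf[OF that] by (simp add: cinner_commute_eq_0[of "f m"])
  have on: "orthonormal_family A g"
    and total: "\<And>x. x \<in> S \<Longrightarrow> (\<And>n. n \<in> N \<Longrightarrow> cinner x (f n) = 0) \<Longrightarrow>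
      (\<And>n. n \<in> A \<Longrightarrow> cinner x (g n) = 0) \<Longrightarrow> x = 0"
    using g by (auto simp: orthonormal_basis_def)
  \<comment> \<open>Halving is injective on each parity class, so distinct positions of equal parity
    refer to distinct vectors of one family.\<close>
  have half: "m div 2 = n div 2 \<longleftrightarrow> m = n" if "even m = even n" for m n :: nat
    using that by (metis dvd_mult_div_cancel odd_two_times_div_two_succ)
  show ?thesis
    unfolding orthonormal_basis_def
  proof (intro conjI ballI impI)
    show "orthonormal_family (interleave_set N A) (interleave f g)"
      unfolding orthonormal_family_def
    proof (intro ballI)
      fix m n assume mn: "m \<in> interleave_set N A" "n \<in> interleave_set N A"
      consider "even m" "even n" | "odd m" "odd n" | "even m \<noteq> even n" by blast
      then show "cinner (interleave f g m) (interleave f g n) = (if m = n then 1 else 0)"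
      proof cases
        case 1
        then show ?thesis
          using mn half[of m n] orthonormal_familyD[OF f(1), of "m div 2" "n div 2"]
          by (simp add: interleave_def interleave_set_def)
      next
        case 2
        then show ?thesis
          using mn half[of m n] orthonormal_familyD[OF on, of "m div 2" "n div 2"]
          by (simp add: interleave_def interleave_set_def)
      next
        case 3
        then have "m \<noteq> n" by blast
        then show ?thesis
          using 3 mn gf[of "m div 2" "n div 2"] fg[of "n div 2" "m div 2"]
          by (auto simp: interleave_def interleave_set_def split: if_splits)
      qed
    qed
    show "interleave f g ` interleave_set N A \<subseteq> S"
      using f(2) gS by (auto simp: interleave_def interleave_set_def)
    fix x assume x: "x \<in> S" "\<forall>n\<in>interleave_set N A. cinner x (interleave f g n) = 0"
    show "x = 0"
    proof (rule total[OF x(1)])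
      show "cinner x (f n) = 0" if "n \<in> N" for n
        using x(2)[rule_format, of "2 * n"] that by (simp add: interleave_def interleave_set_def)
      show "cinner x (g n) = 0" if "n \<in> A" for n
        using x(2)[rule_format, of "2 * n + 1"] that by (simp add: interleave_def interleave_set_def)
    qed
  qed
qed

lemma biorthogonal_bases_of_singular_vectors:
  fixes S T :: "'a::chilbert_space set"
  assumes "orthonormal_family N \<xi>" "orthonormal_family N \<psi>" "\<psi> ` N \<subseteq> S" "\<xi> ` N \<subseteq> T"
    and "\<And>m n. m \<in> N \<Longrightarrow> n \<in> N \<Longrightarrow> m \<noteq> n \<Longrightarrow> cinner (\<xi> n) (\<psi> m) = 0"
    and S0: "{x \<in> S. \<forall>n\<in>N. cinner x (\<psi> n) = 0} = S \<inter> ortho_compl T"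
    and T0: "{x \<in> T. \<forall>n\<in>N. cinner x (\<xi> n) = 0} = T \<inter> ortho_compl S"
    and f: "orthonormal_basis A f (S \<inter> ortho_compl T)" and g: "orthonormal_basis B g (T \<inter> ortho_compl S)"
  shows "biorthogonal_bases (interleave_set N A) (interleave_set N B)
    (interleave \<psi> f) (interleave \<xi> g) S T"
  unfolding biorthogonal_bases_def
proof (intro conjI ballI impI)
  show basis_S: "orthonormal_basis (interleave_set N A) (interleave \<psi> f) S"
    and basis_T: "orthonormal_basis (interleave_set N B) (interleave \<xi> g) T"
    using assms by (auto intro!: orthonormal_basis_interleave)
  fix i j assume ij: "i \<in> interleave_set N A" "j \<in> interleave_set N B" "i \<noteq> j"
  have iS: "interleave \<psi> f i \<in> S" and jT: "interleave \<xi> g j \<in> T"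
    using basis_S basis_T ij by (auto simp: orthonormal_basis_def)
  \<comment> \<open>An odd index selects a completing vector, orthogonal to the whole other space;
    two even indices select singular vectors with different numbers.\<close>
  consider "odd i" | "odd j" | "even i" "even j" "i div 2 \<noteq> j div 2"
    using ij(3) by fastforce
  then show "cinner (interleave \<xi> g j) (interleave \<psi> f i) = 0"
  proof cases
    case 1
    then have "interleave \<psi> f i \<in> ortho_compl T"
      using ij(1) f by (auto simp: interleave_def interleave_set_def orthonormal_basis_def)
    then show ?thesis
      using jT by (simp add: ortho_compl_def cinner_commute_eq_0[of "interleave \<xi> g j"])
  next
    case 2
    then have "interleave \<xi> g j \<in> ortho_compl S"
      using ij(2) g by (auto simp: interleave_def interleave_set_def orthonormal_basis_def)
    then show ?thesis
      using iS by (simp add: ortho_compl_def)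
  next
    case 3
    then show ?thesis
      using ij assms(5) by (simp add: interleave_def interleave_set_def)
  qed
qed

text \<open>Transports a basis without changing its index set, so that two subspaces of equal
  dimension share one.\<close>

lemma orthonormal_basis_isometric_image:
  assumes U: "isometric_on M U" and M: "csubspace M" and f: "orthonormal_basis A f M"
  shows "orthonormal_basis A (U \<circ> f) (U ` M)"
proof -
  have fM: "\<And>n. n \<in> A \<Longrightarrow> f n \<in> M"
    using f by (auto simp: orthonormal_basis_def)
  have "U x = 0" if "x \<in> M" "\<And>n. n \<in> A \<Longrightarrow> cinner x (f n) = 0" for x
  proof -
    have "x = 0" using f that by (simp add: orthonormal_basis_def)
    moreover have "norm (U x) = norm x"
      using U that(1) by (simp add: isometric_on_def)
    ultimately show ?thesis by simp
  qed
  then show ?thesis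
    using f fM by (auto simp: orthonormal_basis_def orthonormal_family_def isometric_on_cinner[OF U M])
qed

text \<open>Relabelling both families by the same bijection keeps matching vectors on the diagonal;
  this spreads an infinite common index set over all naturals.\<close>

lemma biorthogonal_bases_reindex:
  fixes f g :: "nat \<Rightarrow> 'a::complex_inner"
  assumes h: "bij_betw h K I" and fg: "biorthogonal_bases I I f g S T"
  shows "biorthogonal_bases K K (f \<circ> h) (g \<circ> h) S T"
proof -
  have hI: "\<And>k. k \<in> K \<Longrightarrow> h k \<in> I" "h ` K = I"
    and inj: "\<And>k l. k \<in> K \<Longrightarrow> l \<in> K \<Longrightarrow> h k = h l \<longleftrightarrow> k = l"
    using h by (auto simp: bij_betw_def inj_on_eq_iff)
  have "orthonormal_basis K (u \<circ> h) R" if "orthonormal_basis I u R"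
    for u :: "nat \<Rightarrow> 'a" and R
    using that hI(1) inj unfolding orthonormal_basis_def orthonormal_family_def hI(2)[symmetric] by auto
  then show ?thesis
    using fg hI(1) inj unfolding biorthogonal_bases_def by simp
qed

section \<open>The two equivalences\<close>

lemma csubspace_Int_ortho_compl: "csubspace S \<Longrightarrow> csubspace (S \<inter> ortho_compl T)"
  by (auto simp: csubspace_def ortho_compl_def subspace_def cinner_add_left cinner_scaleC_left scaleR_scaleC)

text \<open>The first half lets the coordinate domains vary with the dimensions. Isometries on all
  of \<open>ell2\<close> force \<open>S\<close> and \<open>T\<close> to be infinite dimensional, and
  a diagonal matrix then pairs, at its zero entries, bases of
  \<open>S \<inter> ortho_compl T\<close> and \<open>T \<inter> ortho_compl S\<close>; hence the
  dimension condition in the second half.\<close>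

theorem proposition5p1:
  fixes S T :: "'a::chilbert_space set"
  assumes "csubspace S" "closed S" "csubspace T" "closed T"
    and "separable_space (top_of_set S)" "separable_space (top_of_set T)"
  shows "(S_decomposable (proj S \<circ> proj T) \<longleftrightarrow>
            (\<exists>(I :: nat set) (J :: nat set) (X :: ell2 \<Rightarrow> 'a) (Y :: ell2 \<Rightarrow> 'a).
               coord_isometry I X \<and> coord_isometry J Y \<and> range X = S \<and> range Y = T \<and>
               diagonal_matrix (cadjoint X \<circ> Y)))
       \<and> (infinite_dimensional S \<and> infinite_dimensional T \<and>
            same_hilbert_dim (S \<inter> ortho_compl T) (T \<inter> ortho_compl S) \<longrightarrow>
          (S_decomposable (proj S \<circ> proj T) \<longleftrightarrow>
            (\<exists>(X :: ell2 \<Rightarrow> 'a) (Y :: ell2 \<Rightarrow> 'a).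
               isometry X \<and> isometry Y \<and> range X = S \<and> range Y = T \<and>
               diagonal_matrix (cadjoint X \<circ> Y))))"
proof -
  have S: "closed_separable_csubspace S" and T: "closed_separable_csubspace T"
    using assms by (simp_all add: closed_separable_csubspace_def)
  note iff = diagonal_isometries_iff_biorthogonal_bases[OF assms(1-4)]
  let ?S0 = "S \<inter> ortho_compl T" and ?T0 = "T \<inter> ortho_compl S"
  obtain A f where f: "orthonormal_basis A f ?S0"
    using orthonormal_basis_exists[of ?S0 S] csubspace_Int_ortho_compl assms by blast
  obtain B g where g: "orthonormal_basis B g ?T0"
    using orthonormal_basis_exists[of ?T0 T] csubspace_Int_ortho_compl assms by blast
  \<comment> \<open>The completing bases are left arbitrary: unrelated ones serve the first
    equivalence, ones with a common index set the second.\<close>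
  have bases: "\<exists>N u v. biorthogonal_bases (interleave_set N A) (interleave_set N B) u v S T"
    if dec: "S_decomposable (proj S \<circ> proj T)" and "orthonormal_basis A f ?S0" "orthonormal_basis B g ?T0"
    for A B f g
  proof -
    obtain N \<xi> \<psi>
      where "orthonormal_family N \<xi>" "orthonormal_family N \<psi>" "\<psi> ` N \<subseteq> S" "\<xi> ` N \<subseteq> T"
        "\<And>m n. m \<in> N \<Longrightarrow> n \<in> N \<Longrightarrow> m \<noteq> n \<Longrightarrow> cinner (\<xi> n) (\<psi> m) = 0"
        "{x \<in> S. \<forall>n\<in>N. cinner x (\<psi> n) = 0} = ?S0"
        "{x \<in> T. \<forall>n\<in>N. cinner x (\<xi> n) = 0} = ?T0"
      by (rule S_decomposable_proj_singular_vectors[OF S T dec]) (rule that)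
    from biorthogonal_bases_of_singular_vectors[OF this that(2,3)] show ?thesis by blast
  qed
  have UNIV_bases: "\<exists>f g. biorthogonal_bases UNIV UNIV f g S T"
    if dec: "S_decomposable (proj S \<circ> proj T)" and inf: "infinite_dimensional S"
      and dim: "same_hilbert_dim ?S0 ?T0"
  proof -
    obtain U where U: "isometric_on ?S0 U" "U ` ?S0 = ?T0"
      using dim by (auto simp: same_hilbert_dim_def)
    \<comment> \<open>With \<open>A\<close> indexing both completing bases, the two interleaved
      index sets coincide.\<close>
    have "orthonormal_basis A (U \<circ> f) ?T0"
      using orthonormal_basis_isometric_image[OF U(1) csubspace_Int_ortho_compl[OF assms(1)] f]
      by (simp add: U(2))
    from bases[OF dec f this] obtain K u v where uv: "biorthogonal_bases K K u v S T"
      by blast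
    \<comment> \<open>Being infinite, \<open>K\<close> is enumerated bijectively by all
      naturals.\<close>
    then have "infinite K"
      using orthonormal_basis_finite_dimensional[of K u S] assms(1) inf
      by (auto simp: biorthogonal_bases_def)
    from biorthogonal_bases_reindex[OF bij_enumerate[OF this] uv] show ?thesis by blast
  qed
  have converse: "S_decomposable (proj S \<circ> proj T)" if "biorthogonal_bases I J f g S T" for I J f g
    by (rule S_decomposable_of_biorthogonal_bases[OF S T that])
  show ?thesis
    unfolding coord_isometry_UNIV[symmetric] iff
  proof (intro conjI impI)
    show "S_decomposable (proj S \<circ> proj T) \<longleftrightarrow> (\<exists>I J f g. biorthogonal_bases I J f g S T)"
      using bases[OF _ f g] converse by blast
    show "S_decomposable (proj S \<circ> proj T) \<longleftrightarrow> (\<exists>f g. biorthogonal_bases UNIV UNIV f g S T)"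
      if "infinite_dimensional S \<and> infinite_dimensional T \<and> same_hilbert_dim ?S0 ?T0"
      using that UNIV_bases converse by blast
  qed
qed

end
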